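(* Let $q$ be a prime power with $q\equiv 1\pmod 4$, and put $v=1+q+q^2+q^3$. Then there is a quasi-balanced Butson weighing matrix $W$ of order $v$ and weight $q+q^2$ over $\{1,-1,i,-i\}$ (the complex fourth roots of unity) such that $|W|$ is the adjacency matrix of a strongly regular graph with parameters $(1+q+q^2+q^3,\;q+q^2,\;q-1,\;q+1)$. Furthermore, the complete graph $K_v$ on $v$ vertices decomposes into $q+1$ Siamese strongly regular graphs with parameters $(1+q+q^2+q^3,\;q+q^2,\;q-1,\;q+1)$, signed over the fourth roots of unity, all sharing $1+q^2$ cliques of size $q+1$; that is, there are quasi-balanced Butson weighing matrices $W_0,\dots,W_q$ of order $v$ and weight $q+q^2$ over $\{1,-1,i,-i\}$ and a graph $F$ on the vertex set of $K_v$, with $F$ a disjoint union of $1+q^2$ cliques of size $q+1$, such that each $|W_\ell|$ is the adjacency matrix of a strongly regular graph $\Gamma_\ell$ with parameters $(1+q+q^2+q^3,\;q+q^2,\;q-1,\;q+1)$, every edge of $F$ belongs to all of $\Gamma_0,\dots,\Gamma_q$, and every edge of $K_v$ not in $F$ belongs to exactly one of $\Gamma_0,\dots,\Gamma_q$.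
   Context: Let $\mathcal R_n$ be the set of complex $n$-th roots of unity. A Butson weighing matrix of order $v$ and weight $k$ over $\mathcal R_n$ is a $v\times v$ matrix $W$ with entries in $\{0\}\cup\mathcal R_n$ satisfying $WW^*=kI_v$, where $W^*$ is the conjugate transpose. $|W|$ denotes the entrywise absolute value, $|W|_{ij}=|W_{ij}|$. Such a $W$ is quasi-balanced if $|W|\,|W|^\top=|W|^\top|W|$ and the off-diagonal entries of $|W|\,|W|^\top$ take at most two distinct values. A graph (simple, undirected) on $v$ vertices with adjacency matrix $A$ is strongly regular with parameters $(v,k,\lambda,\mu)$ if $A^2=kI_v+\lambda A+\mu(J_v-I_v-A)$, where $J_v$ is the all-ones matrix. It is signed over $\mathcal R_n$ by $W$ if $W$ is a quasi-balanced Butson weighing matrix over $\mathcal R_n$ with $|W|=A$. *)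

theory Defs
  imports
    "HOL-Library.Disjoint_Sets"
    "HOL-Number_Theory.Prime_Powers"
    "Jordan_Normal_Form.Schur_Decomposition"
    "Graph_Theory.Graph_Theory"
begin

text \<open>
  The order \<open>v\<close> varies with \<open>q\<close>, so matrices are those of \<open>Jordan_Normal_Form\<close> (rows and columns
  indexed by \<open>0, \<dots>, v - 1\<close>), and \<^const>\<open>mat_adjoint\<close> is the conjugate transpose.  A simple graph is
  a \<^locale>\<open>pair_graph\<close>, i.e. a finite, loop-free, symmetric set of ordered pairs: the edge between
  \<open>x\<close> and \<open>y\<close> is represented by both \<open>(x, y)\<close> and \<open>(y, x)\<close>.
\<close>

definition roots_of_unity :: "nat \<Rightarrow> complex set" where
  "roots_of_unity n = {z. z ^ n = 1}"

lemma roots_of_unity_4: "roots_of_unity 4 = {1, -1, \<i>, -\<i>}"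
proof -
  have "z ^ 4 = 1 \<longleftrightarrow> z = 1 \<or> z = -1 \<or> z = \<i> \<or> z = -\<i>" for z :: complex
  proof -
    have "z ^ 4 - 1 = (z - 1) * (z + 1) * (z - \<i>) * (z + \<i>)"
      by (simp add: algebra_simps power4_eq_xxxx)
    moreover have "z ^ 4 = 1 \<longleftrightarrow> z ^ 4 - 1 = 0"
      by simp
    ultimately have "z ^ 4 = 1 \<longleftrightarrow> z - 1 = 0 \<or> z + 1 = 0 \<or> z - \<i> = 0 \<or> z + \<i> = 0"
      by simp
    then show ?thesis
      by (simp add: eq_neg_iff_add_eq_0)
  qed
  then show ?thesis
    by (auto simp: roots_of_unity_def)
qed

definition butson_weighing :: "nat \<Rightarrow> nat \<Rightarrow> nat \<Rightarrow> complex mat \<Rightarrow> bool" where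
  "butson_weighing n v k W \<longleftrightarrow>
     W \<in> carrier_mat v v \<and>
     elements_mat W \<subseteq> {0} \<union> roots_of_unity n \<and>
     W * mat_adjoint W = of_nat k \<cdot>\<^sub>m 1\<^sub>m v"

abbreviation abs_mat :: "complex mat \<Rightarrow> real mat" where
  "abs_mat W \<equiv> map_mat cmod W"

definition off_diagonal_entries :: "'a mat \<Rightarrow> 'a set" where
  "off_diagonal_entries M = {M $$ (i, j) | i j. i < dim_row M \<and> j < dim_col M \<and> i \<noteq> j}"

definition quasi_balanced :: "complex mat \<Rightarrow> bool" where
  "quasi_balanced W \<longleftrightarrow>
     abs_mat W * (abs_mat W)\<^sup>T = (abs_mat W)\<^sup>T * abs_mat W \<and>
     card (off_diagonal_entries (abs_mat W * (abs_mat W)\<^sup>T)) \<le> 2"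

definition all_ones_mat :: "nat \<Rightarrow> real mat" where
  "all_ones_mat v = mat v v (\<lambda>_. 1)"

definition adjacency_mat :: "nat \<Rightarrow> nat pair_pre_digraph \<Rightarrow> real mat" where
  "adjacency_mat v G = mat v v (\<lambda>(i, j). if (i, j) \<in> parcs G then 1 else 0)"

definition strongly_regular ::
    "nat \<Rightarrow> nat \<Rightarrow> nat \<Rightarrow> nat \<Rightarrow> nat pair_pre_digraph \<Rightarrow> bool" where
  "strongly_regular v k l m G \<longleftrightarrow>
     pair_graph G \<and> pverts G = {0..<v} \<and>
     (let A = adjacency_mat v G in
        A * A = real k \<cdot>\<^sub>m 1\<^sub>m v + real l \<cdot>\<^sub>m A + real m \<cdot>\<^sub>m (all_ones_mat v - 1\<^sub>m v - A))"

definition complete_pair_graph :: "nat \<Rightarrow> nat pair_pre_digraph" where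
  "complete_pair_graph v = \<lparr>pverts = {0..<v}, parcs = {(x, y). x < v \<and> y < v \<and> x \<noteq> y}\<rparr>"

lemma complete_digraph_complete_pair_graph:
  "complete_digraph v (with_proj (complete_pair_graph v))"
proof -
  have "finite {(x, y). x < v \<and> y < v \<and> x \<noteq> y}"
    by (rule finite_subset[of _ "{0..<v} \<times> {0..<v}"]) auto
  then interpret pair_graph "complete_pair_graph v"
    by unfold_locales (auto simp: complete_pair_graph_def symmetric_def arcs_ends_conv sym_def)
  have "graph (with_proj (complete_pair_graph v))"
    by unfold_locales
  then show ?thesis
    unfolding complete_digraph_def
    by (auto simp: complete_pair_graph_def arcs_ends_conv)
qed

definition disjoint_union_of_cliques :: "nat \<Rightarrow> nat \<Rightarrow> 'a pair_pre_digraph \<Rightarrow> bool" where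
  "disjoint_union_of_cliques c s F \<longleftrightarrow>
     (\<exists>P. partition_on (pverts F) P \<and> card P = c \<and> (\<forall>C\<in>P. card C = s) \<and>
          parcs F = {(x, y). x \<noteq> y \<and> (\<exists>C\<in>P. x \<in> C \<and> y \<in> C)})"

definition signed_over_by :: "nat \<Rightarrow> nat \<Rightarrow> nat \<Rightarrow> nat pair_pre_digraph \<Rightarrow> complex mat \<Rightarrow> bool" where
  "signed_over_by n v k G W \<longleftrightarrow>
     butson_weighing n v k W \<and> quasi_balanced W \<and> abs_mat W = adjacency_mat v G"

end

theory Submission
  imports Defs "HOL-Number_Theory.Cong"
begin

text \<open>
  Put \<open>n = q + 1\<close>.  Over the field with \<open>q\<^sup>2\<close> elements, with generator \<open>g\<close> of the multiplicative
  group, the determinants of pairs of points of the projective line have logarithms \<open>w x y\<close> that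
  form a balanced generalized weighing matrix.  Replacing an off-diagonal entry by the negacyclic
  Hankel matrix that carries a sign \<open>\<plusminus>1\<close> where \<open>a + b \<equiv> w x y + l (mod n)\<close> gives blocks whose
  products sum to zero over any two rows of blocks, because negacyclic functions have vanishing
  sums over two periods.  The diagonal blocks are \<open>\<i>\<close> times a real negacyclic conference matrix of
  order \<open>n\<close>: the factor \<open>\<i>\<close> makes the two remaining cross terms cancel, provided that \<open>w\<close> is
  symmetric modulo \<open>2 n\<close>, which holds since \<open>-1 = g\<^bsup>(q\<^sup>2 - 1) / 2\<^esup>\<close> and \<open>q \<equiv> 1 (mod 4)\<close>.  The shift
  \<open>l\<close> ranges over the residues modulo \<open>n\<close>, and the diagonal blocks supply the common cliques.

  The field is the quotient of \<open>\<int>[X]\<close> by a maximal ideal that contains the characteristic and all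
  polynomials vanishing at a primitive complex root of unity of order \<open>q\<^sup>2 - 1\<close>.
\<close>

section \<open>Negacyclic and periodic functions\<close>

definition negacyclic :: "nat \<Rightarrow> (int \<Rightarrow> 'a :: comm_ring_1) \<Rightarrow> bool" where
  "negacyclic n f \<longleftrightarrow> (\<forall>m. f (m + int n) = - f m)"

text \<open>Encoding \<open>f\<close> by the sum of f(c) x^c over c < n identifies integer
  negacyclic functions with \<int>[x]/(x^n + 1); this function corresponds to 1.\<close>

definition negacyclic_unit :: "nat \<Rightarrow> int \<Rightarrow> int" where
  "negacyclic_unit n m = (if int n dvd m then if even (m div int n) then 1 else - 1 else 0)"

lemma negacyclic_mult_int:
  assumes "negacyclic n f"
  shows "f (m + int n * k) = (if even k then f m else - f m)"
proof (induction k rule: int_induct[where k = 0])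
  case (step1 i)
  have "f (m + int n * (i + 1)) = - f (m + int n * i)"
    using assms by (simp add: negacyclic_def algebra_simps) (metis add.assoc add.commute)
  then show ?case using step1 by simp
next
  case (step2 i)
  have "f (m + int n * i) = f ((m + int n * (i - 1)) + int n)"
    by (simp add: algebra_simps)
  also have "\<dots> = - f (m + int n * (i - 1))"
    using assms by (simp only: negacyclic_def)
  finally show ?case using step2 by (cases "even i") simp_all
qed simp

lemma negacyclic_reflect:
  assumes "negacyclic n f"
  shows "negacyclic n (\<lambda>m. f (d - m))"
proof -
  have "f (d - (m + int n)) = - f (d - m)" for m
  proof -
    have "f ((d - (m + int n)) + int n) = - f (d - (m + int n))"
      using assms unfolding negacyclic_def by blast
    then show ?thesis by (simp add: algebra_simps)
  qed
  then show ?thesis unfolding negacyclic_def by blast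
qed

lemma negacyclic_unit_negacyclic: "n > 0 \<Longrightarrow> negacyclic n (negacyclic_unit n)"
  by (simp add: negacyclic_def negacyclic_unit_def div_add_self2)

text \<open>Exactly one of 0, ..., n - 1 is congruent to \<open>u\<close>, so at most one term
  survives.\<close>

lemma sum_delta_mod:
  fixes F :: "nat \<Rightarrow> 'a :: comm_monoid_add"
  assumes n: "n > 0" and F: "\<And>c. c < n \<Longrightarrow> \<not> int n dvd u - int c \<Longrightarrow> F c = 0"
  shows "(\<Sum>c<n. F c) = F (nat (u mod int n))"
proof -
  let ?c = "nat (u mod int n)"
  have c: "?c < n" using n by (simp add: nat_less_iff)
  have "F c = 0" if "c < n" "c \<noteq> ?c" for c
  proof (rule F[OF that(1)])
    show "\<not> int n dvd u - int c"
      using that by (auto simp: mod_eq_dvd_iff[symmetric])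
  qed
  then have "(\<Sum>c<n. F c) = (\<Sum>c\<in>{?c}. F c)"
    using c by (intro sum.mono_neutral_right) auto
  then show ?thesis by simp
qed

text \<open>Only c = u mod n contributes, and the sign of the unit at \<open>u - c\<close> is the
  parity of \<open>u div n\<close>, which is the sign that carries \<open>f\<close> from
  \<open>u mod n\<close> back to \<open>u\<close>.\<close>

lemma negacyclic_convolution_unit:
  fixes f :: "int \<Rightarrow> int"
  assumes n: "n > 0" and f: "negacyclic n f"
  shows "(\<Sum>c<n. negacyclic_unit n (u - int c) * f (int c)) = f u"
proof -
  have u: "u = u mod int n + int n * (u div int n)" by simp
  have m: "int (nat (u mod int n)) = u mod int n" using n by simp
  have "(\<Sum>c<n. negacyclic_unit n (u - int c) * f (int c)) =
      negacyclic_unit n (u - u mod int n) * f (u mod int n)"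
    by (subst sum_delta_mod[OF n, of u]) (simp_all only: m, simp add: negacyclic_unit_def)
  also have "u - u mod int n = int n * (u div int n)"
    by (simp add: minus_mod_eq_mult_div)
  also have "negacyclic_unit n (int n * (u div int n)) * f (u mod int n) =
      f (u mod int n + int n * (u div int n))"
    using n unfolding negacyclic_mult_int[OF f] by (simp add: negacyclic_unit_def)
  finally show ?thesis by simp
qed

lemma periodic_mult_int:
  fixes f :: "int \<Rightarrow> 'a"
  assumes "\<And>m. f (m + d) = f m"
  shows "f (m + d * k) = f m"
proof (induction k rule: int_induct[where k = 0])
  case (step1 i)
  then show ?case using assms[of "m + d * i"] by (simp add: algebra_simps)
next
  case (step2 i)
  then show ?case using assms[of "m + d * (i - 1)"] by (simp add: algebra_simps)
qed simp

lemma periodic_dvd: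
  fixes f :: "int \<Rightarrow> 'a"
  assumes "\<And>m. f (m + d) = f m" and "d dvd a - b"
  shows "f a = f b"
proof -
  from assms(2) obtain k where "a - b = d * k" by (rule dvdE)
  then have "a = b + d * k" by simp
  then show ?thesis using periodic_mult_int[of f, OF assms(1)] by simp
qed

lemma periodic_convolution_unit:
  fixes f :: "int \<Rightarrow> int"
  assumes n: "n > 0" and f: "\<And>m. f (m + int n) = f m"
  shows "(\<Sum>c<n. of_bool (int n dvd u - int c) * f (int c)) = f u"
proof -
  have m: "int (nat (u mod int n)) = u mod int n" using n by simp
  have "(\<Sum>c<n. of_bool (int n dvd u - int c) * f (int c)) =
      of_bool (int n dvd u - u mod int n) * f (u mod int n)"
    by (subst sum_delta_mod[OF n, of u]) (simp_all only: m, simp)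
  also have "\<dots> = f (u mod int n)" by (simp add: minus_mod_eq_mult_div)
  also have "\<dots> = f u"
    by (rule periodic_dvd[of f, OF f]) (simp add: mod_eq_dvd_iff[symmetric])
  finally show ?thesis .
qed

lemma sum_mod_image:
  fixes f :: "int \<Rightarrow> 'a :: comm_monoid_add"
  assumes n: "n > 0" and f: "\<And>m. f (m + int n) = f m"
  shows "(\<Sum>c<n. f (int c + a)) = (\<Sum>c<n. f (int c))"
proof -
  have inj: "inj_on (\<lambda>c. nat ((int c + a) mod int n)) {..<n}"
  proof (rule inj_onI)
    fix c d assume cd: "c \<in> {..<n}" "d \<in> {..<n}"
      and "nat ((int c + a) mod int n) = nat ((int d + a) mod int n)"
    then have "(int c + a) mod int n = (int d + a) mod int n"
      using n by (simp add: eq_nat_nat_iff)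
    then have "int c mod int n = int d mod int n"
      by (simp add: mod_eq_dvd_iff)
    then show "c = d" using cd by simp
  qed
  have "(\<lambda>c. nat ((int c + a) mod int n)) ` {..<n} \<subseteq> {..<n}"
    using n by (auto simp: nat_less_iff)
  then have im: "(\<lambda>c. nat ((int c + a) mod int n)) ` {..<n} = {..<n}"
    using card_image[OF inj] by (intro card_subset_eq) auto
  have "(\<Sum>c<n. f (int c)) = (\<Sum>c<n. f (int (nat ((int c + a) mod int n))))"
    using sum.reindex[OF inj, of "\<lambda>c. f (int c)"] by (simp add: im)
  also have "\<dots> = (\<Sum>c<n. f (int c + a))"
  proof (intro sum.cong refl)
    fix c
    have "f ((int c + a) mod int n) = f (int c + a)"
      by (rule periodic_dvd[of f, OF f]) (simp add: mod_eq_dvd_iff[symmetric])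
    then show "f (int (nat ((int c + a) mod int n))) = f (int c + a)" using n by simp
  qed
  finally show ?thesis by simp
qed

lemma sum_div_mod:
  fixes F :: "nat \<Rightarrow> nat \<Rightarrow> 'a :: comm_monoid_add"
  assumes "n > 0"
  shows "(\<Sum>i<m * n. F (i div n) (i mod n)) = (\<Sum>z<m. \<Sum>c<n. F z c)"
proof -
  have "(\<Sum>i<m * n. F (i div n) (i mod n)) =
      (\<Sum>z<m. \<Sum>i\<in>{z * n..<z * n + n}. F (i div n) (i mod n))"
    by (rule sum.nat_group[symmetric])
  also have "\<dots> = (\<Sum>z<m. \<Sum>c<n. F z c)"
  proof (rule sum.cong[OF refl])
    fix z
    have "(\<Sum>i\<in>{0 + z * n..<n + z * n}. F (i div n) (i mod n)) =
        (\<Sum>c\<in>{0..<n}. F ((c + z * n) div n) ((c + z * n) mod n))"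
      by (rule sum.shift_bounds_nat_ivl)
    also have "\<dots> = (\<Sum>c<n. F z c)"
      using assms by (intro sum.cong) auto
    finally show "(\<Sum>i\<in>{z * n..<z * n + n}. F (i div n) (i mod n)) = (\<Sum>c<n. F z c)"
      by (simp add: add.commute)
  qed
  finally show ?thesis .
qed

lemma sum_periodic_multiple:
  fixes f :: "int \<Rightarrow> 'a :: comm_semiring_1"
  assumes n: "n > 0" and f: "\<And>m. f (m + int n) = f m"
  shows "(\<Sum>k<r * n. f (int k + a)) = of_nat r * (\<Sum>c<n. f (int c))"
proof -
  have "(\<Sum>k<r * n. f (int k + a)) = (\<Sum>k<r * n. f (int (k mod n) + a))"
  proof (intro sum.cong refl)
    fix k
    show "f (int k + a) = f (int (k mod n) + a)"
      by (rule periodic_dvd[of f, OF f]) (simp add: mod_eq_dvd_iff[symmetric] zmod_int)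
  qed
  also have "\<dots> = (\<Sum>z<r. \<Sum>c<n. f (int c + a))"
    by (rule sum_div_mod[OF n])
  also have "\<dots> = of_nat r * (\<Sum>c<n. f (int c))"
    by (simp add: sum_mod_image[OF n, of f, OF f])
  finally show ?thesis .
qed

section \<open>Signed Siamese graphs from a balanced weighing matrix\<close>

text \<open>
  The vertex \<open>i\<close> is the pair of the point \<open>i div (q + 1)\<close> of a projective line of order \<open>q\<^sup>2\<close> and
  the residue \<open>i mod (q + 1)\<close>.  The function \<open>w\<close> is a balanced generalized weighing matrix over
  a cyclic group, written additively, and \<open>s\<close> the first row of a negacyclic conference matrix.
\<close>

locale siamese =
  fixes q :: nat and w :: "nat \<Rightarrow> nat \<Rightarrow> int" and s :: "int \<Rightarrow> int"
  assumes odd_q: "odd q"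
    and w_sym: "x \<le> q\<^sup>2 \<Longrightarrow> y \<le> q\<^sup>2 \<Longrightarrow> x \<noteq> y \<Longrightarrow> 2 * (int q + 1) dvd w x y - w y x"
    and w_balanced: "x \<le> q\<^sup>2 \<Longrightarrow> y \<le> q\<^sup>2 \<Longrightarrow> x \<noteq> y \<Longrightarrow>
      bij_betw (\<lambda>z. (w x z - w y z) mod (int q ^ 2 - 1)) ({..q\<^sup>2} - {x, y}) {0..<int q ^ 2 - 1}"
    and s_negacyclic: "negacyclic (q + 1) s"
    and s_range: "s m \<in> {- 1, 0, 1}"
    and s_eq_0_iff: "s m = 0 \<longleftrightarrow> int (q + 1) dvd m"
    and s_correlation: "\<not> int (q + 1) dvd t \<Longrightarrow> (\<Sum>c<q + 1. s (int c) * s (int c + t)) = 0"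
begin

definition n :: nat where "n = q + 1"

abbreviation \<eta> :: "int \<Rightarrow> int" where "\<eta> \<equiv> negacyclic_unit n"

lemma n_pos: "n > 0" by (simp add: n_def)

lemma n_eq: "int n = int q + 1" by (simp add: n_def)

lemmas \<eta>_negacyclic = negacyclic_unit_negacyclic[OF n_pos]

lemma s_shift: "s (m + int n) = - s m" and \<eta>_shift: "\<eta> (m + int n) = - \<eta> m"
  using s_negacyclic \<eta>_negacyclic by (simp_all add: negacyclic_def n_def)

lemma s_zero_iff: "s m = 0 \<longleftrightarrow> int n dvd m"
  unfolding n_def by (rule s_eq_0_iff)

section \<open>Sums of periodic functions over differences of weights\<close>

lemma negacyclic_cong:
  assumes "negacyclic n f" "2 * int n dvd a - b"
  shows "f a = f b"
proof (rule periodic_dvd[of f, OF _ assms(2)])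
  show "f (m + 2 * int n) = f m" for m
    using negacyclic_mult_int[OF assms(1), of m 2] by (simp add: mult.commute)
qed

lemma dvd_n_w_sym:
  assumes "x \<le> q\<^sup>2" "y \<le> q\<^sup>2" "x \<noteq> y"
  shows "int n dvd w x y + d \<longleftrightarrow> int n dvd w y x + d"
proof -
  have "int n dvd w x y - w y x"
    using w_sym[OF assms] unfolding n_eq by (rule dvd_mult_right)
  then have "int n dvd (w x y - w y x) + (w y x + d) \<longleftrightarrow> int n dvd w y x + d"
    by (simp only: dvd_add_right_iff)
  then show ?thesis by simp
qed

text \<open>The right-hand side comes from \<open>q\<^sup>2 - 1 = ((q - 1) / 2) (2 n)\<close>.\<close>

lemma sum_w_balanced:
  fixes f :: "int \<Rightarrow> int"
  assumes xy: "x \<le> q\<^sup>2" "y \<le> q\<^sup>2" "x \<noteq> y" and f: "\<And>m. f (m + 2 * int n) = f m"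
  shows "(\<Sum>z\<in>{..q\<^sup>2} - {x, y}. f (w x z - w y z + a)) =
    int ((q - 1) div 2) * (\<Sum>c<2 * n. f (int c))"
proof -
  obtain j where j: "q = 2 * j + 1" using odd_q by (rule oddE)
  let ?r = "(q - 1) div 2"
  have N: "int q ^ 2 - 1 = int (?r * (2 * n))"
    unfolding n_def by (simp add: j power2_eq_square algebra_simps)
  have "(\<Sum>z\<in>{..q\<^sup>2} - {x, y}. f (w x z - w y z + a)) =
      (\<Sum>z\<in>{..q\<^sup>2} - {x, y}. f ((w x z - w y z) mod (int q ^ 2 - 1) + a))"
  proof (intro sum.cong refl, rule periodic_dvd[of f, OF f])
    fix z
    let ?d = "w x z - w y z"
    have "2 * int n dvd int q ^ 2 - 1" unfolding N by simp
    also have "int q ^ 2 - 1 dvd ?d - ?d mod (int q ^ 2 - 1)"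
      by (simp add: mod_eq_dvd_iff[symmetric])
    finally show "2 * int n dvd ?d + a - (?d mod (int q ^ 2 - 1) + a)" by simp
  qed
  also have "\<dots> = (\<Sum>k\<in>{0..<int q ^ 2 - 1}. f (k + a))"
    by (rule sum.reindex_bij_betw[OF w_balanced[OF xy]])
  also have "\<dots> = (\<Sum>k<?r * (2 * n). f (int k + a))"
  proof -
    have "bij_betw int {..<?r * (2 * n)} {0..<int (?r * (2 * n))}"
      unfolding bij_betw_def lessThan_atLeast0 image_int_atLeastLessThan by simp
    from sum.reindex_bij_betw[OF this, of "\<lambda>k. f (k + a)"] show ?thesis
      unfolding N by (rule sym)
  qed
  also have "\<dots> = int ?r * (\<Sum>c<2 * n. f (int c))"
    using n_pos f by (subst sum_periodic_multiple) (auto simp: of_nat_mult)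
  finally show ?thesis .
qed

lemma sum_double: "(\<Sum>c<2 * n. f (int c)) = (\<Sum>c<n. f (int c) + f (int c + int n))"
  for f :: "int \<Rightarrow> int"
proof -
  have "(\<Sum>c<2 * n. f (int c)) = (\<Sum>c<n. f (int c)) + (\<Sum>c\<in>{n..<n + n}. f (int c))"
    by (simp add: lessThan_atLeast0 mult_2 sum.atLeastLessThan_concat)
  also have "(\<Sum>c\<in>{n..<n + n}. f (int c)) = (\<Sum>c<n. f (int c + int n))"
    using sum.shift_bounds_nat_ivl[of "\<lambda>c. f (int c)" 0 n n]
    by (simp add: lessThan_atLeast0)
  finally show ?thesis by (simp add: sum.distrib)
qed

text \<open>By balance the sum is a multiple of a sum over two periods, whose second half is the
  negative of the first.\<close>

lemma sum_w_\<eta>: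
  assumes "x \<le> q\<^sup>2" "y \<le> q\<^sup>2" "x \<noteq> y"
  shows "(\<Sum>z\<in>{..q\<^sup>2} - {x, y}. \<eta> (w x z - w y z + a)) = 0"
  by (subst sum_w_balanced[OF assms])
    (simp_all add: sum_double \<eta>_shift negacyclic_cong[OF \<eta>_negacyclic])

text \<open>An interval of length 2 n contains two multiples of n, and balance repeats it (q - 1) /
  2 times.\<close>

lemma sum_w_dvd:
  assumes "x \<le> q\<^sup>2" "y \<le> q\<^sup>2" "x \<noteq> y"
  shows "(\<Sum>z\<in>{..q\<^sup>2} - {x, y}. of_bool (int n dvd w x z - w y z + a)) = int q - 1"
proof -
  have one: "(\<Sum>c<n. of_bool (int n dvd int c)) = (1 :: int)"
    using periodic_convolution_unit[OF n_pos, of "\<lambda>_. 1" 0] by simp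
  have "(\<Sum>z\<in>{..q\<^sup>2} - {x, y}. of_bool (int n dvd w x z - w y z + a)) =
      int ((q - 1) div 2) * (\<Sum>c<2 * n. of_bool (int n dvd int c))"
    by (subst sum_w_balanced[OF assms, where f = "\<lambda>m. of_bool (int n dvd m)"])
      (simp_all add: dvd_add_left_iff)
  also have "(\<Sum>c<2 * n. of_bool (int n dvd int c)) = (2 :: int)"
    using one unfolding sum_double[where f = "\<lambda>m. of_bool (int n dvd m)"]
    by (simp add: sum.distrib)
  also have "int ((q - 1) div 2) * 2 = int q - 1"
    using odd_q by (auto elim!: oddE)
  finally show ?thesis .
qed

section \<open>Rows of the negacyclic conference matrix\<close>

lemma sum_s_square: "(\<Sum>c<n. s (int c + t) * s (int c + t)) = int q"
proof -
  have per: "s (m + int n) * s (m + int n) = s m * s m" for m by (simp add: s_shift)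
  have sq: "s m * s m = 1 - of_bool (int n dvd 0 - m) * 1" for m
    using s_range[of m] s_zero_iff[of m] by auto
  have "(\<Sum>c<n. s (int c + t) * s (int c + t)) = (\<Sum>c<n. s (int c) * s (int c))"
    by (rule sum_mod_image[OF n_pos, of "\<lambda>m. s m * s m", OF per])
  also have "\<dots> = int n - (\<Sum>c<n. of_bool (int n dvd 0 - int c) * 1)"
    unfolding sq by (simp only: sum_subtractf sum_constant) simp
  also have "\<dots> = int q"
    by (subst periodic_convolution_unit[OF n_pos, of "\<lambda>_. 1"]) (simp_all add: n_def)
  finally show ?thesis .
qed

lemma s_rows:
  assumes ab: "a < n" "b < n"
  shows "(\<Sum>c<n. s (int a - int c) * s (int b - int c)) = (if a = b then int q else 0)"
proof -
  let ?A = "int a - int q" and ?B = "int b - int q"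
  have "(\<Sum>c<n. s (int a - int c) * s (int b - int c)) =
      (\<Sum>c<n. s (int a - int (n - Suc c)) * s (int b - int (n - Suc c)))"
    by (rule sum.nat_diff_reindex[symmetric])
  also have "\<dots> = (\<Sum>c<n. s (int c + ?A) * s (int c + ?B))"
    by (intro sum.cong refl) (simp add: n_def of_nat_diff algebra_simps)
  also have "\<dots> = (if a = b then int q else 0)"
  proof (cases "a = b")
    case True
    then show ?thesis by (simp add: sum_s_square)
  next
    case False
    have "\<not> int n dvd int b - int a"
      using ab False zdvd_not_zless[of "\<bar>int b - int a\<bar>" "int n"] by auto
    have "(\<Sum>c<n. s (int c + ?A) * s (int c + ?B)) =
        (\<Sum>c<n. s (int c + ?A) * s (int c + ?A + (int b - int a)))"
      by (simp add: algebra_simps)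
    also have "\<dots> = (\<Sum>c<n. s (int c) * s (int c + (int b - int a)))"
    \<comment> \<open>Each factor changes sign under a shift by n, so the product has period n and
      the summation range may be translated.\<close>
    proof (rule sum_mod_image[OF n_pos, of "\<lambda>m. s m * s (m + (int b - int a))"])
      show "s (m + int n) * s (m + int n + (int b - int a)) = s m * s (m + (int b - int a))" for m
        using s_shift[of m] s_shift[of "m + (int b - int a)"] by (simp add: algebra_simps)
    qed
    also have "\<dots> = 0"
      using s_correlation[of "int b - int a"] \<open>\<not> int n dvd int b - int a\<close> by (simp add: n_def)
    finally show ?thesis using False by simp
  qed
  finally show ?thesis .
qed

section \<open>The blocks and their Gram sums\<close>

definition entry :: "nat \<Rightarrow> nat \<Rightarrow> nat \<Rightarrow> nat \<Rightarrow> nat \<Rightarrow> complex" where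
  "entry l x a y b = (if x = y then \<i> * of_int (s (int a - int b))
     else of_int (\<eta> (w x y + int l - int a - int b)))"

text \<open>The diagonal blocks do not involve \<open>l\<close>: they give the same cliques in every
  graph.\<close>

definition adj :: "nat \<Rightarrow> nat \<Rightarrow> nat \<Rightarrow> nat \<Rightarrow> nat \<Rightarrow> int" where
  "adj l x a y b = (if x = y then of_bool (a \<noteq> b)
     else of_bool (int n dvd w x y + int l - int a - int b))"

lemma eq_iff_dvd: "a < n \<Longrightarrow> b < n \<Longrightarrow> int n dvd int a - int b \<longleftrightarrow> a = b"
  by (simp add: mod_eq_dvd_iff[symmetric])

lemma cmod_entry: "a < n \<Longrightarrow> b < n \<Longrightarrow> cmod (entry l x a y b) = of_int (adj l x a y b)"
  using s_range[of "int a - int b"] s_zero_iff[of "int a - int b"] eq_iff_dvd[of a b]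
  by (auto simp: entry_def adj_def norm_mult negacyclic_unit_def)

text \<open>Off-diagonal blocks depend on a + b only, so exchanging the two vertices merely
  exchanges \<open>w x y\<close> and \<open>w y x\<close>, which agree modulo n.\<close>

lemma adj_sym:
  assumes "x \<le> q\<^sup>2" "y \<le> q\<^sup>2"
  shows "adj l x a y b = adj l y b x a"
  using dvd_n_w_sym[OF assms, of "int l - int a - int b"]
  by (auto simp: adj_def algebra_simps)

lemma sum_point_split:
  fixes F :: "nat \<Rightarrow> 'a :: comm_monoid_add"
  assumes "x \<le> q\<^sup>2"
  shows "(\<Sum>z\<le>q\<^sup>2. F z) = F x + (\<Sum>z\<in>{..q\<^sup>2} - {x}. F z)"
  using assms by (simp add: sum.remove)

lemma sum_two_points_split:
  fixes F :: "nat \<Rightarrow> 'a :: comm_monoid_add"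
  assumes "x \<le> q\<^sup>2" "y \<le> q\<^sup>2" "x \<noteq> y"
  shows "(\<Sum>z\<le>q\<^sup>2. F z) = F x + (F y + (\<Sum>z\<in>{..q\<^sup>2} - {x, y}. F z))"
proof -
  have "{..q\<^sup>2} - {x} - {y} = {..q\<^sup>2} - {x, y}" by auto
  moreover have "(\<Sum>z\<in>{..q\<^sup>2} - {x}. F z) = F y + (\<Sum>z\<in>{..q\<^sup>2} - {x} - {y}. F z)"
    using assms by (intro sum.remove) auto
  ultimately show ?thesis
    by (simp only: sum_point_split[OF assms(1), of F])
qed

text \<open>The reflected unit is negacyclic, so convolution with the unit evaluates it at
  \<open>u\<close> and yields \<eta>(v - u). Evenness of \<eta> holds because k and -k have the same
  parity.\<close>

lemma \<eta>_convolution: "(\<Sum>c<n. \<eta> (u - int c) * \<eta> (v - int c)) = \<eta> (u - v)"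
proof -
  have "\<eta> m = \<eta> (- m)" for m
  proof (cases "int n dvd m")
    case True
    then obtain k where m: "m = int n * k" by (rule dvdE)
    have nz: "int n \<noteq> 0" using n_pos by simp
    show ?thesis
      unfolding m mult_minus_right[symmetric] negacyclic_unit_def
        nonzero_mult_div_cancel_left[OF nz] by simp
  qed (simp add: negacyclic_unit_def)
  from this[of "v - u"] have "\<eta> (v - u) = \<eta> (u - v)" by simp
  then show ?thesis
    using negacyclic_convolution_unit[OF n_pos negacyclic_reflect[OF \<eta>_negacyclic]] by simp
qed

lemma dvd_convolution:
  "(\<Sum>c<n. of_bool (int n dvd u - int c) * of_bool (int n dvd v - int c)) = (of_bool (int n dvd u - v) :: int)"
proof -
  have "(\<Sum>c<n. of_bool (int n dvd u - int c) * of_bool (int n dvd v - int c)) =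
      (of_bool (int n dvd v - u) :: int)"
    by (rule periodic_convolution_unit[OF n_pos, of "\<lambda>m. of_bool (int n dvd v - m)"])
      (simp add: diff_diff_eq[symmetric] dvd_diff_left_iff)
  also have "int n dvd v - u \<longleftrightarrow> int n dvd u - v" by (rule dvd_diff_commute)
  finally show ?thesis .
qed

text \<open>Within one row of blocks, each of the q^2 off-diagonal blocks contributes the identity
  and the diagonal block q times it. For two rows of blocks, the columns \<open>z\<close> other than
  \<open>x\<close> and \<open>y\<close> cancel by balance, and the two columns containing a diagonal
  block cancel each other.\<close>

lemma entry_gram:
  assumes xy: "x \<le> q\<^sup>2" "y \<le> q\<^sup>2" and ab: "a < n" "b < n"
  shows "(\<Sum>z\<le>q\<^sup>2. \<Sum>c<n. entry l x a z c * cnj (entry l y b z c)) =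
    (if x = y \<and> a = b then of_nat (q + q\<^sup>2) else 0)"
proof (cases "x = y")
  case True
  have "(\<Sum>c<n. entry l x a z c * cnj (entry l y b z c)) = of_bool (a = b)"
    if "z \<in> {..q\<^sup>2} - {x}" for z
  proof -
    have "(\<Sum>c<n. entry l x a z c * cnj (entry l y b z c)) =
        of_int (\<Sum>c<n. \<eta> (w x z + int l - int a - int c) * \<eta> (w x z + int l - int b - int c))"
      using that True by (auto simp: entry_def)
    also have "\<dots> = of_int (\<eta> (int b - int a))"
      by (simp only: \<eta>_convolution) simp
    also have "\<eta> (int b - int a) = of_bool (a = b)"
      using eq_iff_dvd[OF ab(2,1)] by (simp add: negacyclic_unit_def)
    finally show ?thesis by simp
  qed
  then have "(\<Sum>z\<in>{..q\<^sup>2} - {x}. \<Sum>c<n. entry l x a z c * cnj (entry l y b z c)) =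
      of_nat (q\<^sup>2) * of_bool (a = b)"
    using xy by simp
  moreover have "(\<Sum>c<n. entry l x a x c * cnj (entry l y b x c)) =
      of_int (\<Sum>c<n. s (int a - int c) * s (int b - int c))"
    unfolding of_int_sum
  proof (intro sum.cong refl)
    fix c
    have "\<i> * u * (- \<i> * v) = - (\<i> * \<i>) * (u * v)" for u v :: complex
      by (simp only: mult_ac mult_minus_left mult_minus_right)
    then show "entry l x a x c * cnj (entry l y b x c) = of_int (s (int a - int c) * s (int b - int c))"
      using True by (simp add: entry_def)
  qed
  ultimately show ?thesis
    using True by (simp add: sum_point_split[OF xy(1)] s_rows[OF ab])
next
  case False
  have "(\<Sum>c<n. entry l x a z c * cnj (entry l y b z c)) =
      of_int (\<eta> (w x z - w y z + (int b - int a)))"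
    if "z \<in> {..q\<^sup>2} - {x, y}" for z
  proof -
    have "(\<Sum>c<n. entry l x a z c * cnj (entry l y b z c)) =
        of_int (\<Sum>c<n. \<eta> (w x z + int l - int a - int c) * \<eta> (w y z + int l - int b - int c))"
      using that by (auto simp: entry_def)
    also have "\<dots> = of_int (\<eta> (w x z - w y z + (int b - int a)))"
      by (simp only: \<eta>_convolution) (simp add: algebra_simps)
    finally show ?thesis .
  qed
  then have rest: "(\<Sum>z\<in>{..q\<^sup>2} - {x, y}. \<Sum>c<n. entry l x a z c * cnj (entry l y b z c)) = 0"
    using sum_w_\<eta>[OF xy False, of "int b - int a"] by (simp add: of_int_sum[symmetric] del: of_int_sum)
  have conv: "(\<Sum>c<n. \<eta> (u - int c) * s (d - int c)) = s (d - u)" for u d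
    using s_negacyclic by (intro negacyclic_convolution_unit n_pos negacyclic_reflect) (simp add: n_def)
  have "(\<Sum>c<n. entry l x a x c * cnj (entry l y b x c)) =
      \<i> * of_int (\<Sum>c<n. \<eta> (w y x + int l - int b - int c) * s (int a - int c))"
    using False by (auto simp: entry_def sum_distrib_left mult_ac)
  also have "\<dots> = \<i> * of_int (s (int a - (w y x + int l - int b)))"
    by (simp only: conv)
  finally have X: "(\<Sum>c<n. entry l x a x c * cnj (entry l y b x c)) =
      \<i> * of_int (s (int a - (w y x + int l - int b)))" .
  have "(\<Sum>c<n. entry l x a y c * cnj (entry l y b y c)) =
      - \<i> * of_int (\<Sum>c<n. \<eta> (w x y + int l - int a - int c) * s (int b - int c))"
    using False by (auto simp: entry_def sum_distrib_left mult_ac sum_negf)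
  also have "\<dots> = - \<i> * of_int (s (int b - (w x y + int l - int a)))"
    by (simp only: conv)
  finally have Y: "(\<Sum>c<n. entry l x a y c * cnj (entry l y b y c)) =
      - \<i> * of_int (s (int b - (w x y + int l - int a)))" .
  \<comment> \<open>The arguments differ by \<open>w x y - w y x\<close>, a multiple of the period 2
    n of \<open>s\<close>; so X and Y have opposite values, their factors being \<i> and its
    conjugate.\<close>
  have "s (int a - (w y x + int l - int b)) = s (int b - (w x y + int l - int a))"
    using w_sym[OF xy False] s_negacyclic
    by (intro negacyclic_cong) (simp_all add: n_def algebra_simps)
  then show ?thesis
    using False by (simp add: sum_two_points_split[OF xy False] X Y rest)
qed

text \<open>This counts common neighbours. Two vertices of one clique share the other n - 2 = q - 1
  clique members and nothing outside. For vertices in different cliques the blocks \<open>z\<close>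
  outside \<open>x\<close>, \<open>y\<close> give q - 1, and each of the blocks \<open>x\<close>,
  \<open>y\<close> adds 1 exactly when the vertices are not adjacent.\<close>

lemma adj_gram:
  assumes xy: "x \<le> q\<^sup>2" "y \<le> q\<^sup>2" and ab: "a < n" "b < n"
  shows "(\<Sum>z\<le>q\<^sup>2. \<Sum>c<n. adj l x a z c * adj l y b z c) =
    (if x = y \<and> a = b then int (q + q\<^sup>2)
     else if adj l x a y b = 1 then int q - 1 else int q + 1)"
proof (cases "x = y")
  case True
  have "(\<Sum>c<n. adj l x a z c * adj l y b z c) = of_bool (a = b)"
    if "z \<in> {..q\<^sup>2} - {x}" for z
  proof -
    have "(\<Sum>c<n. adj l x a z c * adj l y b z c) =
        (\<Sum>c<n. of_bool (int n dvd (w x z + int l - int a) - int c) *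
          of_bool (int n dvd (w x z + int l - int b) - int c))"
      using that True by (auto simp: adj_def)
    also have "\<dots> = of_bool (int n dvd int b - int a)"
      by (simp only: dvd_convolution) simp
    finally show ?thesis using eq_iff_dvd[OF ab(2,1)] by auto
  qed
  then have "(\<Sum>z\<in>{..q\<^sup>2} - {x}. \<Sum>c<n. adj l x a z c * adj l y b z c) = int (q\<^sup>2) * of_bool (a = b)"
    using xy by simp
  moreover have "(\<Sum>c<n. adj l x a x c * adj l y b x c) = int n - int (card {a, b})"
  proof -
    have "(\<Sum>c<n. adj l x a x c * adj l y b x c) = (\<Sum>c<n. of_bool (c \<in> {..<n} - {a, b}))"
      using True by (intro sum.cong refl) (auto simp: adj_def)
    also have "\<dots> = int (card ({..<n} \<inter> ({..<n} - {a, b})))"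
      by (simp only: of_bool_def sum.If_cases[OF finite_lessThan] sum_constant Collect_mem_eq)
    also have "\<dots> = int (card ({..<n} - {a, b}))" by (simp add: Int_absorb1)
    also have "\<dots> = int n - int (card {a, b})"
      using ab card_mono[of "{..<n}" "{a, b}"] by (simp add: card_Diff_subset of_nat_diff)
    finally show ?thesis .
  qed
  ultimately show ?thesis
    using True by (auto simp: sum_point_split[OF xy(1)] adj_def n_def)
next
  case False
  have "(\<Sum>c<n. adj l x a z c * adj l y b z c) =
      of_bool (int n dvd w x z - w y z + (int b - int a))"
    if "z \<in> {..q\<^sup>2} - {x, y}" for z
  proof -
    have "(\<Sum>c<n. adj l x a z c * adj l y b z c) =
        (\<Sum>c<n. of_bool (int n dvd (w x z + int l - int a) - int c) *
          of_bool (int n dvd (w y z + int l - int b) - int c))"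
      using that by (auto simp: adj_def)
    also have "\<dots> = of_bool (int n dvd w x z - w y z + (int b - int a))"
      by (simp only: dvd_convolution) (simp add: algebra_simps)
    finally show ?thesis .
  qed
  then have rest: "(\<Sum>z\<in>{..q\<^sup>2} - {x, y}. \<Sum>c<n. adj l x a z c * adj l y b z c) = int q - 1"
    using sum_w_dvd[OF xy False, of "int b - int a"] by simp
  \<comment> \<open>A row of an off-diagonal block has a single 1; paired with a row of J - I, that
    1 is lost only if it sits in the excluded column \<open>d\<close>.\<close>
  have conv: "(\<Sum>c<n. of_bool (int n dvd u - int c) * of_bool (d \<noteq> c)) =
      1 - (of_bool (int n dvd u - int d) :: int)" if d: "d < n" for u d
  proof -
    have "(\<Sum>c<n. of_bool (int n dvd u - int c) * of_bool (d \<noteq> c)) =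
        (\<Sum>c<n. of_bool (int n dvd u - int c) * (1 - of_bool (int n dvd int d - int c)) :: int)"
      using eq_iff_dvd[OF d] by (intro sum.cong refl) auto
    also have "\<dots> = (\<Sum>c<n. of_bool (int n dvd u - int c) * 1) -
        (\<Sum>c<n. of_bool (int n dvd u - int c) * of_bool (int n dvd int d - int c))"
      by (simp add: sum_subtractf right_diff_distrib)
    also have "\<dots> = 1 - of_bool (int n dvd u - int d)"
      by (subst periodic_convolution_unit[OF n_pos, of "\<lambda>_. 1"]) (simp_all only: dvd_convolution)
    finally show ?thesis .
  qed
  have "(\<Sum>c<n. adj l x a x c * adj l y b x c) =
      (\<Sum>c<n. of_bool (int n dvd (w y x + int l - int b) - int c) * of_bool (a \<noteq> c))"
    using False by (simp add: adj_def mult.commute)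
  also have "\<dots> = 1 - of_bool (int n dvd (w y x + int l - int b) - int a)"
    by (rule conv[OF ab(1)])
  also have "\<dots> = 1 - adj l x a y b"
    using False dvd_n_w_sym[OF xy False, of "int l - int b - int a"]
    by (simp add: adj_def algebra_simps)
  finally have X: "(\<Sum>c<n. adj l x a x c * adj l y b x c) = 1 - adj l x a y b" .
  have "(\<Sum>c<n. adj l x a y c * adj l y b y c) =
      (\<Sum>c<n. of_bool (int n dvd (w x y + int l - int a) - int c) * of_bool (b \<noteq> c))"
    using False by (simp add: adj_def mult.commute)
  also have "\<dots> = 1 - adj l x a y b"
    using False by (simp add: conv[OF ab(2)] adj_def)
  finally have Y: "(\<Sum>c<n. adj l x a y c * adj l y b y c) = 1 - adj l x a y b" .
  have "adj l x a y b \<in> {0, 1}" by (simp add: adj_def)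
  then show ?thesis
    using False by (auto simp: sum_two_points_split[OF xy False] X Y rest)
qed

section \<open>The matrices, the graphs and the common cliques on the vertices 0, ..., v - 1\<close>

definition v :: nat where "v = (q\<^sup>2 + 1) * n"

definition W :: "nat \<Rightarrow> complex mat" where
  "W l = mat v v (\<lambda>(i, j). entry l (i div n) (i mod n) (j div n) (j mod n))"

definition vadj :: "nat \<Rightarrow> nat \<Rightarrow> nat \<Rightarrow> int" where
  "vadj l i j = adj l (i div n) (i mod n) (j div n) (j mod n)"

definition \<Gamma> :: "nat \<Rightarrow> nat pair_pre_digraph" where
  "\<Gamma> l = \<lparr>pverts = {0..<v}, parcs = {(i, j). i < v \<and> j < v \<and> vadj l i j = 1}\<rparr>"

definition F :: "nat pair_pre_digraph" where
  "F = \<lparr>pverts = {0..<v}, parcs = {(i, j). i < v \<and> j < v \<and> i \<noteq> j \<and> i div n = j div n}\<rparr>"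

lemma v_eq: "v = 1 + q + q\<^sup>2 + q ^ 3"
  by (simp add: v_def n_def algebra_simps power2_eq_square power3_eq_cube)

lemma div_n_le: "i < v \<Longrightarrow> i div n \<le> q\<^sup>2"
  unfolding v_def div_less_iff_less_mult[OF n_pos, symmetric] by simp

lemma mod_n_less: "i mod n < n"
  using n_pos by simp

lemma vertex_eq_iff: "i div n = j div n \<and> i mod n = j mod n \<longleftrightarrow> i = j"
  by (metis div_mult_mod_eq)

lemma vadj_cases: "vadj l i j = 0 \<or> vadj l i j = 1"
  by (simp add: vadj_def adj_def)

lemma vadj_refl: "vadj l i i = 0"
  by (simp add: vadj_def adj_def)

lemma vadj_sym: "i < v \<Longrightarrow> j < v \<Longrightarrow> vadj l i j = vadj l j i"
  by (simp add: vadj_def adj_sym div_n_le)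

lemma sum_vertices:
  "(\<Sum>k\<in>{0..<v}. G (k div n) (k mod n)) = (\<Sum>z\<le>q\<^sup>2. \<Sum>c<n. G z c)"
  for G :: "nat \<Rightarrow> nat \<Rightarrow> 'b :: comm_monoid_add"
  using sum_div_mod[OF n_pos, of G "q\<^sup>2 + 1"]
  by (simp add: v_def atLeast0LessThan lessThan_Suc_atMost)

lemma vadj_gram:
  assumes "i < v" "j < v"
  shows "(\<Sum>k\<in>{0..<v}. vadj l i k * vadj l j k) =
    (if i = j then int (q + q\<^sup>2) else if vadj l i j = 1 then int q - 1 else int q + 1)"
proof -
  have "(\<Sum>k\<in>{0..<v}. vadj l i k * vadj l j k) =
      (\<Sum>z\<le>q\<^sup>2. \<Sum>c<n. adj l (i div n) (i mod n) z c * adj l (j div n) (j mod n) z c)"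
    unfolding vadj_def by (rule sum_vertices)
  then show ?thesis
    using adj_gram[OF div_n_le[OF assms(1)] div_n_le[OF assms(2)] mod_n_less mod_n_less]
    by (simp add: vertex_eq_iff vadj_def)
qed

lemma adjacency_\<Gamma>: "adjacency_mat v (\<Gamma> l) = mat v v (\<lambda>(i, j). of_int (vadj l i j))"
  using vadj_cases by (intro eq_matI) (force simp: adjacency_mat_def \<Gamma>_def)+

lemma abs_W: "abs_mat (W l) = adjacency_mat v (\<Gamma> l)"
  unfolding adjacency_\<Gamma>
  by (intro eq_matI) (simp_all add: W_def vadj_def cmod_entry mod_n_less)

lemma pair_graph_\<Gamma>: "pair_graph (\<Gamma> l)"
proof -
  have "finite (parcs (\<Gamma> l))"
    by (rule finite_subset[of _ "{0..<v} \<times> {0..<v}"]) (auto simp: \<Gamma>_def)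
  then show ?thesis
    by unfold_locales (auto simp: \<Gamma>_def symmetric_def arcs_ends_conv sym_def vadj_refl vadj_sym)
qed

lemma pair_graph_F: "pair_graph F"
proof -
  have "finite (parcs F)"
    by (rule finite_subset[of _ "{0..<v} \<times> {0..<v}"]) (auto simp: F_def)
  then show ?thesis
    by unfold_locales (auto simp: F_def symmetric_def arcs_ends_conv sym_def)
qed

lemma adjacency_square_entry:
  assumes "i < v" "j < v"
  shows "(adjacency_mat v (\<Gamma> l) * adjacency_mat v (\<Gamma> l)) $$ (i, j) =
    (if i = j then real (q + q\<^sup>2) else if vadj l i j = 1 then real q - 1 else real q + 1)"
proof -
  have "(adjacency_mat v (\<Gamma> l) * adjacency_mat v (\<Gamma> l)) $$ (i, j) =
      (\<Sum>k\<in>{0..<v}. real_of_int (vadj l i k) * real_of_int (vadj l k j))"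
    using assms by (simp add: adjacency_\<Gamma> scalar_prod_def)
  also have "\<dots> = real_of_int (\<Sum>k\<in>{0..<v}. vadj l i k * vadj l j k)"
    using assms by (simp add: vadj_sym[of _ j])
  finally show ?thesis by (simp add: vadj_gram[OF assms])
qed

lemma strongly_regular_\<Gamma>: "strongly_regular v (q + q\<^sup>2) (q - 1) (q + 1) (\<Gamma> l)"
proof -
  let ?A = "adjacency_mat v (\<Gamma> l)"
  \<comment> \<open>The parameter \<open>q - 1\<close> is a truncated difference of naturals;
    oddness of \<open>q\<close> makes it the true one.\<close>
  have q1: "real (q - 1) = real q - 1" using odd_q by (simp add: of_nat_diff odd_pos Suc_leI)
  have "?A * ?A = real (q + q\<^sup>2) \<cdot>\<^sub>m 1\<^sub>m v + real (q - 1) \<cdot>\<^sub>m ?A +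
      real (q + 1) \<cdot>\<^sub>m (all_ones_mat v - 1\<^sub>m v - ?A)" (is "_ = ?R")
  proof (rule eq_matI)
    fix i j assume "i < dim_row ?R" "j < dim_col ?R"
    then have ij: "i < v" "j < v" by (simp_all add: adjacency_\<Gamma>)
    show "(?A * ?A) $$ (i, j) = ?R $$ (i, j)"
      unfolding adjacency_square_entry[OF ij]
      using ij vadj_cases[of l i j] q1 by (auto simp: adjacency_\<Gamma> all_ones_mat_def vadj_refl)
  qed (simp_all add: adjacency_\<Gamma>)
  moreover have "pverts (\<Gamma> l) = {0..<v}" by (simp add: \<Gamma>_def)
  ultimately show ?thesis
    unfolding strongly_regular_def Let_def using pair_graph_\<Gamma> by blast
qed

lemma butson_weighing_W: "butson_weighing 4 v (q + q\<^sup>2) (W l)"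
proof -
  have carrier: "W l \<in> carrier_mat v v" by (simp add: W_def)
  have "entry l x a y b \<in> {0} \<union> roots_of_unity 4" for x a y b
    using s_range[of "int a - int b"] by (auto simp: entry_def negacyclic_unit_def roots_of_unity_4)
  then have "elements_mat (W l) \<subseteq> {0} \<union> roots_of_unity 4"
    by (auto simp: elements_mat_def W_def)
  moreover have "W l * mat_adjoint (W l) = of_nat (q + q\<^sup>2) \<cdot>\<^sub>m 1\<^sub>m v"
  proof (rule eq_matI)
    fix i j assume "i < dim_row (of_nat (q + q\<^sup>2) \<cdot>\<^sub>m 1\<^sub>m v :: complex mat)"
      "j < dim_col (of_nat (q + q\<^sup>2) \<cdot>\<^sub>m 1\<^sub>m v :: complex mat)"
    then have ij: "i < v" "j < v" by simp_all
    have "(W l * mat_adjoint (W l)) $$ (i, j) =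
        (\<Sum>k\<in>{0..<v}. entry l (i div n) (i mod n) (k div n) (k mod n) *
          cnj (entry l (j div n) (j mod n) (k div n) (k mod n)))"
      using ij by (simp add: W_def mat_adjoint_def scalar_prod_def mat_of_rows_def)
    also have "\<dots> = (\<Sum>z\<le>q\<^sup>2. \<Sum>c<n. entry l (i div n) (i mod n) z c * cnj (entry l (j div n) (j mod n) z c))"
      by (rule sum_vertices)
    also have "\<dots> = (if i = j then of_nat (q + q\<^sup>2) else 0)"
      using entry_gram[OF div_n_le[OF ij(1)] div_n_le[OF ij(2)] mod_n_less mod_n_less]
      by (simp add: vertex_eq_iff)
    finally show "(W l * mat_adjoint (W l)) $$ (i, j) = (of_nat (q + q\<^sup>2) \<cdot>\<^sub>m 1\<^sub>m v) $$ (i, j)"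
      using ij by simp
  qed (simp_all add: W_def mat_adjoint_def)
  ultimately show ?thesis
    using carrier by (simp add: butson_weighing_def)
qed

text \<open>|W| is symmetric, so both products are the square of the adjacency matrix, whose
  off-diagonal entries are the two parameters q - 1 and q + 1.\<close>

lemma quasi_balanced_W: "quasi_balanced (W l)"
proof -
  let ?A = "adjacency_mat v (\<Gamma> l)"
  have T: "?A\<^sup>T = ?A"
    by (intro eq_matI) (simp_all add: adjacency_\<Gamma> vadj_sym)
  have dim: "dim_row ?A = v" "dim_col ?A = v" by (simp_all add: adjacency_\<Gamma>)
  have "off_diagonal_entries (?A * ?A) \<subseteq> {real q - 1, real q + 1}"
  proof -
    have "(?A * ?A) $$ (i, j) \<in> {real q - 1, real q + 1}" if "i < v" "j < v" "i \<noteq> j" for i j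
      unfolding adjacency_square_entry[OF that(1,2)] using that by simp
    then show ?thesis
      by (auto simp: off_diagonal_entries_def dim simp del: index_mult_mat(1))
  qed
  then have "card (off_diagonal_entries (?A * ?A)) \<le> card {real q - 1, real q + 1}"
    by (intro card_mono) auto
  also have "\<dots> \<le> 2" by (simp add: card_insert_if)
  finally show ?thesis
    by (simp add: quasi_balanced_def abs_W T)
qed

lemma signed_\<Gamma>: "signed_over_by 4 v (q + q\<^sup>2) (\<Gamma> l) (W l)"
  by (simp add: signed_over_by_def butson_weighing_W quasi_balanced_W abs_W)

lemma disjoint_union_of_cliques_F: "disjoint_union_of_cliques (1 + q\<^sup>2) (q + 1) F"
proof -
  define C where "C x = {x * n..<x * n + n}" for x
  have C_iff: "i \<in> C x \<longleftrightarrow> i div n = x" for i x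
  proof
    assume "i \<in> C x"
    then show "i div n = x" by (intro div_nat_eqI) (auto simp: C_def mult.commute)
  next
    assume "i div n = x"
    then show "i \<in> C x"
      using dividend_less_times_div[OF n_pos, of i] by (auto simp: C_def mult.commute add.commute)
  qed
  have card_C: "card (C x) = n" for x by (simp add: C_def)
  let ?P = "C ` {..q\<^sup>2}"
  have ne: "C x \<noteq> {}" for x using n_pos by (simp add: C_def)
  then have "x = y" if "C x = C y" for x y
    using that by (metis C_iff all_not_in_conv)
  then have "inj_on C {..q\<^sup>2}" by (rule inj_onI)
  then have "card ?P = 1 + q\<^sup>2" by (simp add: card_image)
  moreover have "\<Union>?P = {0..<v}"
  proof -
    have "i < v \<longleftrightarrow> i div n \<le> q\<^sup>2" for i
      unfolding v_def div_less_iff_less_mult[OF n_pos, symmetric] by (simp add: less_Suc_eq_le)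
    moreover have "i \<in> \<Union>?P \<longleftrightarrow> i div n \<le> q\<^sup>2" for i
      by (simp only: UN_iff C_iff atMost_iff) blast
    ultimately show ?thesis
      unfolding set_eq_iff atLeastLessThan_iff by (simp only: le0 simp_thms)
  qed
  then have "partition_on (pverts F) ?P"
    using ne by (auto simp: partition_on_def disjoint_def C_iff F_def)
  moreover have "parcs F = {(x, y). x \<noteq> y \<and> (\<exists>D\<in>?P. x \<in> D \<and> y \<in> D)}"
    using \<open>\<Union>?P = {0..<v}\<close> by (auto simp: F_def C_iff)
  ultimately show ?thesis
    unfolding disjoint_union_of_cliques_def using card_C by (auto simp: n_def intro!: exI[of _ ?P])
qed

lemma F_in_\<Gamma>: "e \<in> parcs F \<Longrightarrow> e \<in> parcs (\<Gamma> l)"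
  using vertex_eq_iff by (auto simp: F_def \<Gamma>_def vadj_def adj_def)

text \<open>Vertices (x, a) and (y, b) in different cliques are adjacent exactly when l is congruent
  to a + b - w x y modulo n, and 0, ..., q is a complete system of residues.\<close>

lemma unique_\<Gamma>:
  assumes "e \<in> parcs (complete_pair_graph v) - parcs F"
  shows "\<exists>!l. l \<le> q \<and> e \<in> parcs (\<Gamma> l)"
proof -
  obtain i j where e: "e = (i, j)" by fastforce
  with assms have ij: "i < v" "j < v" "i div n \<noteq> j div n"
    by (auto simp: complete_pair_graph_def F_def)
  define u where "u = int (i mod n) + int (j mod n) - w (i div n) (j div n)"
  have mem: "e \<in> parcs (\<Gamma> l) \<longleftrightarrow> int n dvd int l - u" for l
    using ij by (simp add: e \<Gamma>_def vadj_def adj_def u_def algebra_simps)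
  show ?thesis
  proof (intro ex1I[of _ "nat (u mod int n)"] conjI)
    have "nat (u mod int n) < n" using n_pos by (simp add: nat_less_iff)
    then show "nat (u mod int n) \<le> q" using n_def by linarith
    show "e \<in> parcs (\<Gamma> (nat (u mod int n)))"
      using n_pos by (simp add: mem mod_eq_dvd_iff[symmetric])
    fix l assume "l \<le> q \<and> e \<in> parcs (\<Gamma> l)"
    then have "l \<le> q" "int l mod int n = u mod int n"
      by (simp_all add: mem mod_eq_dvd_iff)
    moreover from \<open>l \<le> q\<close> have "int l mod int n = int l" by (simp add: n_def)
    ultimately show "l = nat (u mod int n)" by simp
  qed
qed

end

section \<open>The field with \<open>q\<^sup>2\<close> elements\<close>

lemma prod_minus_roots_unity:
  fixes x \<zeta> :: complex
  assumes "N > 0" and \<zeta>: "\<zeta> = cis (2 * pi / N)"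
  shows "(\<Prod>k<N. x - \<zeta> ^ k) = x ^ N - 1"
proof -
  let ?R = "{z :: complex. z ^ N = 1}"
  \<comment> \<open>Both polynomials are monic of degree N, so a nonzero difference would have
    degree below N and yet N roots.\<close>
  define d where "d = monom 1 N - 1 - (\<Prod>z\<in>?R. [:-z, 1 :: complex:])"
  have fin: "finite ?R" and card: "card ?R = N"
    using assms finite_roots_unity[of N] card_roots_unity_eq[of N] by auto
  have bij: "bij_betw (\<lambda>k. \<zeta> ^ k) {..<N} ?R"
    using bij_betw_roots_unity[OF assms(1)] by (simp add: \<zeta> DeMoivre mult_ac)
  have deg: "degree (\<Prod>z\<in>?R. [:-z, 1:]) = N"
    by (simp add: degree_prod_eq_sum_degree card)
  have lead: "coeff (\<Prod>z\<in>?R. [:-z, 1:]) N = 1"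
    using lead_coeff_prod[of "\<lambda>z. [:-z, 1:]" ?R] by (simp add: deg)
  have "degree d \<le> N"
    unfolding d_def using deg by (intro degree_diff_le) (auto simp: degree_monom_le)
  moreover have "coeff d N = 0"
    using assms(1) by (simp add: d_def lead)
  ultimately have "d = 0 \<or> degree d < N"
    by (metis le_neq_implies_less leading_coeff_0_iff)
  moreover have "d = 0" if "degree d < N"
  proof (rule ccontr)
    assume "d \<noteq> 0"
    have "?R \<subseteq> {z. poly d z = 0}"
    proof
      fix z assume z: "z \<in> ?R"
      then have "poly (\<Prod>z\<in>?R. [:-z, 1:]) z = 0"
        using fin by (auto simp: poly_prod intro!: prod_zero)
      with z show "z \<in> {z. poly d z = 0}"
        by (simp add: d_def poly_monom)
    qed
    then have "N \<le> card {z. poly d z = 0}"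
      using card_mono[OF poly_roots_finite[OF \<open>d \<noteq> 0\<close>]] card by metis
    also have "\<dots> \<le> degree d"
      using card_poly_roots_bound[OF \<open>d \<noteq> 0\<close>] .
    finally show False using that by simp
  qed
  ultimately have "d = 0" by blast
  then have "poly d x = 0" by simp
  then have "x ^ N - 1 = (\<Prod>z\<in>?R. x - z)"
    by (simp add: d_def poly_monom poly_prod)
  also have "\<dots> = (\<Prod>k<N. x - \<zeta> ^ k)"
    using prod.reindex_bij_betw[OF bij, of "\<lambda>z. x - z"] by simp
  finally show ?thesis by simp
qed

text \<open>Elements of \<int>[\<zeta>] are algebraic integers, while 1/p is rational and not an
  integer. This makes the ideal generated by p in \<int>[\<zeta>] proper.\<close>

lemma inverse_prime_not_integer_combination_roots_unity:
  fixes \<zeta> :: complex and p :: nat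
  assumes N: "N > 0" and \<zeta>: "\<zeta> ^ N = 1" and p: "p > 1"
  shows "of_nat p * poly (map_poly of_int f) \<zeta> \<noteq> 1"
proof
  define x where "x = poly (map_poly of_int f) \<zeta>"
  assume "of_nat p * poly (map_poly of_int f) \<zeta> = 1"
  then have px: "of_nat p * x = 1" by (simp add: x_def)
  \<comment> \<open>\<open>a i j\<close> is the coefficient of \<zeta>^j in \<zeta>^i f(\<zeta>)
    once exponents are reduced modulo N; so the vector of powers of \<zeta> is an eigenvector of an
    integer matrix with eigenvalue \<open>x\<close>.\<close>
  define a where "a i j = (\<Sum>k\<le>degree f. if (k + i) mod N = j then coeff f k else 0)" for i j
  define A where "A = mat N N (\<lambda>(i, j). a i j)"
  let ?A = "map_mat complex_of_int A"
  define v where "v = vec N (\<lambda>j. \<zeta> ^ j)"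
  have A: "A \<in> carrier_mat N N" by (simp add: A_def)
  have pow: "\<zeta> ^ (m mod N) = \<zeta> ^ m" for m
    by (metis \<zeta> mod_mult_div_eq mult.right_neutral power_add power_mult power_one)
  have row: "(\<Sum>j<N. of_int (a i j) * \<zeta> ^ j) = x * \<zeta> ^ i" for i
  proof -
    have "(\<Sum>j<N. of_int (a i j) * \<zeta> ^ j) =
        (\<Sum>j<N. \<Sum>k\<le>degree f. if (k + i) mod N = j then of_int (coeff f k) * \<zeta> ^ j else 0)"
      by (simp add: a_def sum_distrib_right of_int_sum if_distrib[of of_int] if_distrib[of "\<lambda>u. u * _"] cong: if_cong)
    also have "\<dots> = (\<Sum>k\<le>degree f. \<Sum>j<N. if (k + i) mod N = j then of_int (coeff f k) * \<zeta> ^ j else 0)"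
      by (rule sum.swap)
    also have "\<dots> = (\<Sum>k\<le>degree f. of_int (coeff f k) * \<zeta> ^ (k + i))"
      using N by (intro sum.cong refl) (simp add: pow)
    also have "\<dots> = x * \<zeta> ^ i"
      by (simp add: x_def poly_altdef sum_distrib_left power_add mult_ac)
    finally show ?thesis .
  qed
  have "?A *\<^sub>v v = x \<cdot>\<^sub>v v"
    using row by (intro eq_vecI) (auto simp: A_def v_def scalar_prod_def atLeast0LessThan)
  moreover have "v \<in> carrier_vec N" "v \<noteq> 0\<^sub>v N"
    using N by (auto simp: v_def vec_eq_iff)
  ultimately have "eigenvalue ?A x"
    using A by (auto simp: eigenvalue_def eigenvector_def)
  then have "poly (char_poly ?A) x = 0"
    using eigenvalue_root_char_poly[of ?A N] A by auto
  then have root: "poly (map_poly of_int (char_poly A)) x = 0"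
    by (simp add: of_int_hom.char_poly_hom[OF A])
  have "algebraic_int x"
    using degree_monic_char_poly[OF A] root by (auto simp: algebraic_int_altdef_ipoly)
  moreover have "x = 1 / of_nat p"
    using px p by (simp add: field_simps)
  then have "x \<in> \<rat>" by simp
  ultimately have "x \<in> \<int>"
    by (rule rational_algebraic_int_is_int)
  then obtain z where "x = of_int z" by (auto elim: Ints_cases)
  with px have "of_int (int p * z) = (of_int 1 :: complex)" by simp
  then have "int p * z = 1" by (simp only: of_int_eq_iff)
  then have "int p dvd 1" by (metis dvd_triv_left)
  with p show False by simp
qed

section \<open>Congruence modulo an ideal, the Frobenius map and maximal ideals\<close>

locale proper_ideal =
  fixes M :: "'a :: comm_ring_1 set"
  assumes zero_mem: "0 \<in> M"
    and add_mem: "x \<in> M \<Longrightarrow> y \<in> M \<Longrightarrow> x + y \<in> M"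
    and mult_mem: "x \<in> M \<Longrightarrow> r * x \<in> M"
    and one_notin: "1 \<notin> M"
begin

lemma minus_mem: "x \<in> M \<Longrightarrow> - x \<in> M"
  using mult_mem[of x "-1"] by simp

lemma diff_mem: "x \<in> M \<Longrightarrow> y \<in> M \<Longrightarrow> x - y \<in> M"
  using add_mem[of x "-y"] minus_mem by simp

lemma mult_mem_right: "x \<in> M \<Longrightarrow> x * r \<in> M"
  using mult_mem[of x r] by (simp add: mult.commute)

lemma sum_mem: "(\<And>i. i \<in> S \<Longrightarrow> f i \<in> M) \<Longrightarrow> sum f S \<in> M"
  by (induction S rule: infinite_finite_induct) (auto simp: zero_mem add_mem)

definition cong_ideal :: "'a \<Rightarrow> 'a \<Rightarrow> bool" (infix "\<approx>" 50) where
  "x \<approx> y \<longleftrightarrow> x - y \<in> M"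

lemma cong_refl [simp, intro]: "x \<approx> x"
  by (simp add: cong_ideal_def zero_mem)

lemma cong_sym: "x \<approx> y \<Longrightarrow> y \<approx> x"
  unfolding cong_ideal_def using minus_mem by fastforce

lemma cong_trans [trans]: "x \<approx> y \<Longrightarrow> y \<approx> z \<Longrightarrow> x \<approx> z"
  unfolding cong_ideal_def using add_mem by fastforce

lemma cong_add: "x \<approx> y \<Longrightarrow> x' \<approx> y' \<Longrightarrow> x + x' \<approx> y + y'"
  unfolding cong_ideal_def using add_mem[of "x - y" "x' - y'"] by (simp add: algebra_simps)

lemma cong_diff: "x \<approx> y \<Longrightarrow> x' \<approx> y' \<Longrightarrow> x - x' \<approx> y - y'"
  unfolding cong_ideal_def using diff_mem[of "x - y" "x' - y'"] by (simp add: algebra_simps)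

lemma cong_mult: "x \<approx> y \<Longrightarrow> x' \<approx> y' \<Longrightarrow> x * x' \<approx> y * y'"
  unfolding cong_ideal_def
  using add_mem[OF mult_mem_right[of "x - y" x'] mult_mem[of "x' - y'" y]]
  by (simp add: algebra_simps)

lemma cong_pow: "x \<approx> y \<Longrightarrow> x ^ n \<approx> y ^ n"
  by (induction n) (auto intro: cong_mult)

lemma cong_mem_iff: "x \<approx> y \<Longrightarrow> x \<in> M \<longleftrightarrow> y \<in> M"
  unfolding cong_ideal_def using add_mem[of "x - y" y] diff_mem[of x "x - y"] by auto

lemma cong_0_iff: "x \<approx> 0 \<longleftrightarrow> x \<in> M"
  by (simp add: cong_ideal_def)

text \<open>The binomial coefficients strictly between the ends are divisible by \<open>p\<close>,
  hence lie in the ideal.\<close>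

lemma frobenius_prime:
  assumes p: "prime p" "of_nat p \<in> M"
  shows "(x + y) ^ p \<approx> x ^ p + y ^ p"
proof -
  let ?t = "\<lambda>k. of_nat (p choose k) * x ^ k * y ^ (p - k)"
  have p0: "p > 0" using p by (simp add: prime_gt_0_nat)
  have "{..p} = insert 0 (insert p {1..<p})" using p0 by auto
  then have "(x + y) ^ p = x ^ p + y ^ p + (\<Sum>k\<in>{1..<p}. ?t k)"
    using p0 by (simp add: binomial_ring add_ac)
  moreover have "?t k \<in> M" if "k \<in> {1..<p}" for k
  proof -
    have "p dvd p choose k" using that p by (intro dvd_choose_prime) auto
    then obtain c where "p choose k = p * c" by (rule dvdE)
    then have "?t k = of_nat p * (of_nat c * x ^ k * y ^ (p - k))"
      by (simp add: mult_ac)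
    then show ?thesis using mult_mem_right[OF p(2)] by metis
  qed
  then have "(\<Sum>k\<in>{1..<p}. ?t k) \<in> M" by (rule sum_mem)
  ultimately show ?thesis
    by (simp add: cong_ideal_def)
qed

lemma frobenius:
  assumes p: "prime p" "of_nat p \<in> M"
  shows "(x + y) ^ (p ^ e) \<approx> x ^ (p ^ e) + y ^ (p ^ e)"
proof (induction e)
  case (Suc e)
  have "(x + y) ^ (p ^ Suc e) = ((x + y) ^ (p ^ e)) ^ p"
    by (simp add: power_mult[symmetric] mult.commute)
  also have "\<dots> \<approx> (x ^ (p ^ e) + y ^ (p ^ e)) ^ p"
    by (intro cong_pow Suc)
  also have "\<dots> \<approx> (x ^ (p ^ e)) ^ p + (y ^ (p ^ e)) ^ p"
    by (rule frobenius_prime[OF p])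
  finally show ?case by (simp add: power_mult[symmetric] mult.commute)
qed simp

text \<open>By Zorn's lemma, since 1 is in no member of a chain and hence not in its union.
  Maximality is recorded as invertibility modulo \<open>M'\<close>, the form in which it makes the
  quotient a field.\<close>

lemma exists_maximal_ideal:
  obtains M' where "proper_ideal M'" "M \<subseteq> M'" "\<And>x. x \<notin> M' \<Longrightarrow> \<exists>r. 1 - r * x \<in> M'"
proof -
  let ?\<A> = "{J. proper_ideal J \<and> M \<subseteq> J}"
  have "\<exists>M'\<in>?\<A>. \<forall>J\<in>?\<A>. M' \<subseteq> J \<longrightarrow> J = M'"
  proof (rule subset_Zorn_nonempty)
    show "?\<A> \<noteq> {}" using proper_ideal_axioms by auto
  next
    fix \<C> assume ne: "\<C> \<noteq> {}" and ch: "subset.chain ?\<A> \<C>"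
    then have sub: "\<C> \<subseteq> ?\<A>" and lin: "\<And>A B. A \<in> \<C> \<Longrightarrow> B \<in> \<C> \<Longrightarrow> A \<subseteq> B \<or> B \<subseteq> A"
      by (auto simp: subset_chain_def)
    have "proper_ideal (\<Union>\<C>)"
    proof
      show "0 \<in> \<Union>\<C>" using ne sub by (auto simp: proper_ideal_def)
      show "1 \<notin> \<Union>\<C>" using sub by (auto simp: proper_ideal_def)
      show "r * x \<in> \<Union>\<C>" if "x \<in> \<Union>\<C>" for r x
      proof -
        from that obtain A where A: "A \<in> \<C>" "x \<in> A" by auto
        then have "r * x \<in> A" using sub proper_ideal.mult_mem by blast
        with A(1) show ?thesis by blast
      qed
      show "x + y \<in> \<Union>\<C>" if xy: "x \<in> \<Union>\<C>" "y \<in> \<Union>\<C>" for x y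
      proof -
        from xy obtain A B where AB: "A \<in> \<C>" "x \<in> A" "B \<in> \<C>" "y \<in> B" by auto
        obtain C where "C \<in> \<C>" "x \<in> C" "y \<in> C"
          using lin[OF AB(1,3)] AB by blast
        then have "x + y \<in> C" using sub proper_ideal.add_mem by blast
        with \<open>C \<in> \<C>\<close> show ?thesis by blast
      qed
    qed
    then show "\<Union>\<C> \<in> ?\<A>" using ne sub by auto
  qed
  then obtain M' where M': "proper_ideal M'" "M \<subseteq> M'"
    and max: "\<And>J. proper_ideal J \<Longrightarrow> M' \<subseteq> J \<Longrightarrow> J = M'"
    by (smt (verit) mem_Collect_eq subset_trans)
  interpret M': proper_ideal M' by (rule M')
  have "\<exists>r. 1 - r * x \<in> M'" if x: "x \<notin> M'" for x
  proof (rule ccontr)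
    assume nex: "\<not> ?thesis"
    \<comment> \<open>The ideal generated by \<open>M'\<close> and \<open>x\<close>; it omits 1
      precisely because \<open>x\<close> is assumed to have no inverse modulo
      \<open>M'\<close>.\<close>
    let ?J = "{y. \<exists>r. y - r * x \<in> M'}"
    have "proper_ideal ?J"
    proof
      show "0 \<in> ?J" by (auto intro!: exI[of _ 0] simp: M'.zero_mem)
      show "1 \<notin> ?J" using nex by auto
      show "y + z \<in> ?J" if "y \<in> ?J" "z \<in> ?J" for y z
      proof -
        from that obtain r s where "y - r * x \<in> M'" "z - s * x \<in> M'" by auto
        from M'.add_mem[OF this] have "y + z - (r + s) * x \<in> M'" by (simp add: algebra_simps)
        then show ?thesis by blast
      qed
      show "t * y \<in> ?J" if "y \<in> ?J" for t y
      proof -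
        from that obtain r where "y - r * x \<in> M'" by auto
        from M'.mult_mem[OF this, of t] have "t * y - (t * r) * x \<in> M'" by (simp add: algebra_simps)
        then show ?thesis by blast
      qed
    qed
    moreover have "M' \<subseteq> ?J" by (auto intro!: exI[of _ 0])
    ultimately have "?J = M'" by (rule max)
    moreover have "x \<in> ?J" by (auto intro!: exI[of _ 1] simp: M'.zero_mem)
    ultimately show False using x by blast
  qed
  with M' show thesis by (rule that)
qed

end

text \<open>
  The quotient by \<open>M\<close> is a field with \<open>q\<^sup>2\<close> elements, namely \<open>0\<close> and the powers of \<open>g\<close>.  Computing
  in the ambient ring modulo \<open>M\<close> avoids a type or a carrier for this field.
\<close>

locale galois_ideal = proper_ideal M for M :: "'a :: comm_ring_1 set" +
  fixes g :: 'a and q :: nat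
  assumes q_gt_1: "q > 1"
    and log_exists: "x \<notin> M \<Longrightarrow> \<exists>k<q\<^sup>2 - 1. x - g ^ k \<in> M"
    and gen_order: "g ^ k - 1 \<in> M \<longleftrightarrow> (q\<^sup>2 - 1) dvd k"
    and frob: "(x + y) ^ q - (x ^ q + y ^ q) \<in> M"

text \<open>Modulo M every f satisfies f^(q^2) = f, so outside M it is a root of T^N - 1. That
  polynomial splits into the factors T - X^k because it does so over \<int>[\<zeta>]; hence f is a
  power of X.\<close>

lemma exists_galois_ideal:
  assumes p: "prime p" and e: "e > 0"
  obtains M :: "int poly set" where "galois_ideal M [:0, 1:] (p ^ e)"
proof -
  define q where "q = p ^ e"
  define N where "N = q\<^sup>2 - 1"
  define \<zeta> where "\<zeta> = cis (2 * pi / N)"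
  define ev where "ev f = poly (map_poly of_int f) \<zeta>" for f :: "int poly"
  let ?X = "[:0, 1:] :: int poly"
  have q1: "q > 1" unfolding q_def using p e by (metis one_less_power prime_gt_1_nat)
  then have "q\<^sup>2 > 1" by (metis one_less_power pos2)
  then have N: "N > 0" and Q: "q\<^sup>2 = Suc N" by (simp_all add: N_def)
  have \<zeta>N: "\<zeta> ^ N = 1"
    using N by (simp add: \<zeta>_def DeMoivre)
  have ev_add: "ev (f + h) = ev f + ev h" and ev_mult: "ev (f * h) = ev f * ev h"
    and ev_diff: "ev (f - h) = ev f - ev h"
    and ev_X: "ev ?X = \<zeta>" and ev_0: "ev 0 = 0" and ev_1: "ev 1 = 1"
    and ev_nat: "ev (of_nat m) = of_nat m" for f h m
    by (simp_all add: ev_def hom_distribs)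
  have ev_pow: "ev (f ^ k) = ev f ^ k" for f k
    by (induction k) (simp_all add: ev_1 ev_mult)
  have ev_sum: "ev (sum F S) = (\<Sum>i\<in>S. ev (F i))" for F and S :: "nat set"
    by (induction S rule: infinite_finite_induct) (simp_all add: ev_0 ev_add)
  have ev_prod: "ev (prod F S) = (\<Prod>i\<in>S. ev (F i))" for F and S :: "nat set"
    by (induction S rule: infinite_finite_induct) (simp_all add: ev_1 ev_mult)
  \<comment> \<open>The preimage under \<open>ev\<close> of the ideal generated by p in
    \<int>[\<zeta>].\<close>
  let ?I = "{f. \<exists>h. ev (f - of_nat p * h) = 0}"
  have "proper_ideal ?I"
  proof
    show "0 \<in> ?I" by (auto intro!: exI[of _ 0] simp: ev_0)
    show "1 \<notin> ?I"
      using inverse_prime_not_integer_combination_roots_unity[OF N \<zeta>N prime_gt_1_nat[OF p]]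
      by (auto simp: ev_diff ev_mult ev_1 ev_nat ev_def[symmetric]) 
    show "x + y \<in> ?I" if "x \<in> ?I" "y \<in> ?I" for x y
    proof -
      from that obtain h k where "ev (x - of_nat p * h) = 0" "ev (y - of_nat p * k) = 0" by auto
      then have "ev (x + y - of_nat p * (h + k)) = 0"
        by (simp add: ev_diff ev_add ev_mult algebra_simps)
      then show ?thesis by blast
    qed
    show "r * x \<in> ?I" if "x \<in> ?I" for r x
    proof -
      from that obtain h where "ev (x - of_nat p * h) = 0" by auto
      then have "ev (r * x - of_nat p * (r * h)) = 0"
        by (simp add: ev_diff ev_mult algebra_simps)
      then show ?thesis by blast
    qed
  qed
  moreover define I where "I = ?I"
  ultimately have "proper_ideal I" by simp
  then obtain M where "proper_ideal M" and "I \<subseteq> M"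
    and max: "\<And>x. x \<notin> M \<Longrightarrow> \<exists>r. 1 - r * x \<in> M"
    using proper_ideal.exists_maximal_ideal by metis
  then have IM: "?I \<subseteq> M" by (simp add: I_def)
  interpret proper_ideal M by fact
  write cong_ideal (infix "\<approx>" 50)
  \<comment> \<open>Through this inclusion, identities between powers of \<zeta> become congruences
    between powers of X.\<close>
  have ker: "f \<in> M" if "ev f = 0" for f
  proof -
    have "ev (f - of_nat p * 0) = 0" using that by simp
    then show ?thesis using IM by blast
  qed
  have pM: "of_nat p \<in> M"
  proof -
    have "ev (of_nat p - of_nat p * 1) = 0" by (simp add: ev_0)
    then show ?thesis using IM by blast
  qed
  have XN: "?X ^ N \<approx> 1"
    unfolding cong_ideal_def by (rule ker) (simp add: ev_diff ev_pow ev_X ev_1 \<zeta>N)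
  have prime_ideal: "x \<in> M" if "y \<notin> M" "x * y \<in> M" for x y
  proof -
    obtain r where "1 - r * y \<in> M" using max \<open>y \<notin> M\<close> by blast
    from add_mem[OF mult_mem[OF this, of x] mult_mem[OF that(2), of r]]
    show ?thesis by (simp add: algebra_simps)
  qed
  \<comment> \<open>The polynomials with this property are closed under sums and products and
    contain the constants and X, hence are all of them.\<close>
  have fix_q2: "f ^ q\<^sup>2 \<approx> f" for f
  proof -
    let ?G = "\<lambda>f :: int poly. f ^ q\<^sup>2 \<approx> f"
    have qe: "q\<^sup>2 = p ^ (e * 2)" by (simp add: q_def power_mult)
    have q2: "q\<^sup>2 > 0" using q1 by simp
    have add: "?G (f + h)" if "?G f" "?G h" for f h
    proof -
      have "(f + h) ^ q\<^sup>2 \<approx> f ^ q\<^sup>2 + h ^ q\<^sup>2"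
        unfolding qe by (rule frobenius[OF p pM])
      also have "\<dots> \<approx> f + h" using that by (rule cong_add)
      finally show ?thesis .
    qed
    have mult: "?G (f * h)" if "?G f" "?G h" for f h
      using cong_mult[OF that] by (simp add: power_mult_distrib)
    \<comment> \<open>Additivity applied to 1 + (-1) = 0 treats odd and even characteristic
      alike.\<close>
    have neg1: "?G (-1)"
    proof -
      have "(1 + - 1) ^ q\<^sup>2 \<approx> (1 :: int poly) ^ q\<^sup>2 + (- 1) ^ q\<^sup>2"
        unfolding qe by (rule frobenius[OF p pM])
      then have "0 - (1 + (- 1) ^ q\<^sup>2) \<in> M"
        by (simp add: cong_ideal_def zero_power[OF q2])
      from minus_mem[OF this] show ?thesis
        by (simp add: cong_ideal_def add.commute)
    qed
    have zero: "?G 0" by (simp add: zero_power[OF q2])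
    have one: "?G 1" by simp
    have const: "?G (of_int a)" for a
    proof (induction a rule: int_induct[where k = 0])
      case (step1 i)
      then show ?case using add[of "of_int i" 1] one by simp
    next
      case (step2 i)
      then show ?case using add[of "of_int i" "-1"] neg1 by simp
    qed (use zero in simp)
    have X: "?G ?X"
      using cong_mult[OF cong_refl[of ?X] XN] by (simp add: Q)
    show ?thesis
    proof (induction f)
      case 0
      show ?case by (rule zero)
    next
      case (pCons a f)
      have "?G (of_int a + ?X * f)" by (intro add mult const X pCons)
      then show ?case by (simp add: of_int_poly)
    qed
  qed
  have "galois_ideal M ?X q"
  proof
    show "q > 1" by (rule q1)
    show "(x + y) ^ q - (x ^ q + y ^ q) \<in> M" for x y
      using frobenius[OF p pM] by (simp add: q_def cong_ideal_def)
    show "?X ^ k - 1 \<in> M \<longleftrightarrow> (q\<^sup>2 - 1) dvd k" for k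
    proof
      assume "(q\<^sup>2 - 1) dvd k"
      then obtain c where "k = N * c" unfolding N_def by (rule dvdE)
      then show "?X ^ k - 1 \<in> M"
        using cong_pow[OF XN, of c] by (simp add: power_mult cong_ideal_def)
    next
      assume k: "?X ^ k - 1 \<in> M"
      show "(q\<^sup>2 - 1) dvd k"
      proof (rule ccontr)
        assume ndvd: "\<not> (q\<^sup>2 - 1) dvd k"
        have "\<zeta> ^ k \<noteq> 1"
        proof
          assume "\<zeta> ^ k = 1"
          then have "cis (2 * pi * (k / N)) = 1" by (simp add: \<zeta>_def DeMoivre mult_ac)
          then have "cos (2 * pi * (k / N)) = 1" by (simp add: complex_eq_iff)
          then obtain z :: int where "2 * pi * (k / N) = z * 2 * pi"
            by (auto simp: cos_one_2pi_int)
          then have "2 * pi * (k / N) = 2 * pi * of_int z" by (simp only: mult_ac)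
          then have "real k / real N = of_int z" by (subst (asm) mult_cancel_left) simp
          then have "real k = of_int z * real N" using N by (simp add: field_simps)
          then have "real_of_int (int k) = real_of_int (z * int N)" by simp
          then have "int k = z * int N" by (simp only: of_int_eq_iff)
          then have "N dvd k" by (metis dvd_triv_right int_dvd_int_iff)
          with ndvd show False by (simp add: N_def)
        qed
        \<comment> \<open>The geometric sum vanishes at \<zeta>, so the corresponding sum in X lies
          in M; but each of its N terms is congruent to 1, which puts N into M.\<close>
        then have "(\<Sum>i<N. (\<zeta> ^ k) ^ i) = ((\<zeta> ^ k) ^ N - 1) / (\<zeta> ^ k - 1)"
          by (rule geometric_sum)
        also have "(\<zeta> ^ k) ^ N = 1"
          by (metis \<zeta>N mult.commute power_mult power_one)
        finally have "(\<Sum>i<N. ?X ^ (k * i)) \<in> M"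
          by (intro ker) (simp add: ev_sum ev_pow ev_X power_mult)
        moreover have "(?X ^ k) ^ i \<approx> 1" for i
          using cong_pow[of "?X ^ k" 1 i] k by (simp add: cong_ideal_def)
        then have "(\<Sum>i<N. ?X ^ (k * i) - 1) \<in> M"
          by (intro sum_mem) (simp add: cong_ideal_def power_mult)
        then have "(\<Sum>i<N. ?X ^ (k * i)) - of_nat N \<in> M"
          by (simp add: sum_subtractf)
        ultimately have NM: "of_nat N \<in> M"
          using diff_mem by fastforce
        \<comment> \<open>Since p divides q^2 = N + 1, membership of N forces 1 into M.\<close>
        have "p dvd q\<^sup>2" unfolding q_def power2_eq_square using e by (intro dvd_mult dvd_power) simp
        then obtain c where "q\<^sup>2 = p * c" by (rule dvdE)
        then have "of_nat (q\<^sup>2) \<in> M" using mult_mem_right[OF pM] by simp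
        then have "of_nat (Suc N) - of_nat N \<in> M" using NM diff_mem unfolding Q by blast
        then show False using one_notin by simp
      qed
    qed
    show "\<exists>k<q\<^sup>2 - 1. x - ?X ^ k \<in> M" if x: "x \<notin> M" for x
    proof -
      have "(x ^ N - 1) * x \<in> M"
        using fix_q2[of x] by (simp add: cong_ideal_def Q algebra_simps)
      then have "x ^ N - 1 \<in> M" by (rule prime_ideal[OF x])
      moreover have "(\<Prod>k<N. x - ?X ^ k) - (x ^ N - 1) \<in> M"
        using prod_minus_roots_unity[OF N \<zeta>_def, of "ev x"]
        by (intro ker) (simp add: ev_diff ev_prod ev_pow ev_X ev_1)
      ultimately have "(\<Prod>k<N. x - ?X ^ k) \<in> M"
        using add_mem by fastforce
      moreover have "\<exists>k<m. x - ?X ^ k \<in> M" if "(\<Prod>k<m. x - ?X ^ k) \<in> M" for m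
        using that
      proof (induction m)
        case (Suc m)
        then show ?case
          using prime_ideal[of "x - ?X ^ m" "\<Prod>k<m. x - ?X ^ k"]
          by (auto simp: less_Suc_eq mult.commute)
      qed (use one_notin in simp)
      ultimately show ?thesis by (simp add: N_def)
    qed
  qed
  then show thesis unfolding q_def by (rule that)
qed

section \<open>The weighing matrix and the conference matrix of the field\<close>

context galois_ideal
begin

section \<open>Powers of the generator and discrete logarithms\<close>

definition N :: nat where "N = q\<^sup>2 - 1"

lemma N_eq: "N = (q + 1) * (q - 1)"
  unfolding N_def using q_gt_1 by (cases q) (simp_all add: power2_eq_square)

lemma N_pos: "N > 0"
  using q_gt_1 by (simp add: N_eq)

lemma Suc_N: "Suc N = q\<^sup>2"
  using q_gt_1 by (simp add: N_def)

lemma pow_cong_1_iff: "g ^ k \<approx> 1 \<longleftrightarrow> N dvd k"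
  using gen_order[of k] by (simp add: cong_ideal_def N_def)

text \<open>\<open>g ^ (N * k - k)\<close> inverts \<open>g ^ k\<close> modulo M; the multiple
  \<open>N * k\<close> keeps the exponent a natural number.\<close>

lemma pow_notin: "g ^ k \<notin> M"
proof
  assume "g ^ k \<in> M"
  then have "g ^ k * g ^ (N * k - k) \<in> M" by (rule mult_mem_right)
  also have "g ^ k * g ^ (N * k - k) = g ^ (N * k)"
    using N_pos by (simp add: power_add[symmetric])
  finally show False
    using pow_cong_1_iff[of "N * k"] cong_mem_iff one_notin by auto
qed

lemma mult_pow_mem_iff: "g ^ k * x \<in> M \<longleftrightarrow> x \<in> M"
proof
  assume "g ^ k * x \<in> M"
  then have "g ^ (N * k - k) * (g ^ k * x) \<in> M" by (rule mult_mem)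
  also have "g ^ (N * k - k) * (g ^ k * x) = g ^ (N * k) * x"
    using N_pos by (simp add: power_add[symmetric] mult.assoc[symmetric])
  finally have "g ^ (N * k) * x \<in> M" .
  moreover have "g ^ (N * k) * x \<approx> 1 * x"
    by (intro cong_mult cong_refl) (simp add: pow_cong_1_iff)
  ultimately show "x \<in> M" using cong_mem_iff by force
qed (rule mult_mem)

lemma pow_cong_iff: "g ^ i \<approx> g ^ j \<longleftrightarrow> [i = j] (mod N)"
proof (induction i j rule: linorder_wlog)
  case (le i j)
  have "g ^ j - g ^ i = g ^ i * (g ^ (j - i) - 1)"
    using le by (simp add: algebra_simps power_add[symmetric])
  then have "g ^ j \<approx> g ^ i \<longleftrightarrow> N dvd j - i"
    using mult_pow_mem_iff pow_cong_1_iff by (simp add: cong_ideal_def)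
  also have "\<dots> \<longleftrightarrow> [i = j] (mod N)"
    using le by (simp add: cong_sym_eq[of i j] cong_altdef_nat)
  finally show ?case using cong_sym by blast
next
  case (sym i j)
  then show ?case by (metis cong_sym Cong.cong_sym)
qed

definition lg :: "'a \<Rightarrow> nat" where
  "lg x = (SOME k. k < N \<and> x \<approx> g ^ k)"

lemma
  assumes "x \<notin> M"
  shows lg_less: "lg x < N" and pow_lg: "x \<approx> g ^ lg x"
  using someI_ex[of "\<lambda>k. k < N \<and> x \<approx> g ^ k"] log_exists[OF assms]
  by (auto simp: lg_def N_def cong_ideal_def)

lemma lg_eqI:
  assumes "x \<approx> g ^ k"
  shows "lg x = k mod N"
proof -
  have x: "x \<notin> M" using assms cong_mem_iff pow_notin by blast
  have "g ^ lg x \<approx> g ^ k"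
    using cong_trans[OF cong_sym[OF pow_lg[OF x]] assms] .
  then show ?thesis
    using lg_less[OF x] by (simp add: pow_cong_iff Cong.cong_def)
qed

lemma lg_cong: "x \<notin> M \<Longrightarrow> x \<approx> y \<Longrightarrow> lg y = lg x"
  using lg_eqI[of y "lg x"] cong_trans[OF cong_sym pow_lg] lg_less by simp

lemma mult_mem_iff: "x * y \<in> M \<longleftrightarrow> x \<in> M \<or> y \<in> M"
proof
  assume xy: "x * y \<in> M"
  show "x \<in> M \<or> y \<in> M"
  proof (rule ccontr)
    assume *: "\<not> ?thesis"
    then have "x * y \<approx> g ^ lg x * g ^ lg y" by (intro cong_mult pow_lg) auto
    then have "g ^ (lg x + lg y) \<in> M" using xy cong_mem_iff by (simp add: power_add)
    then show False using pow_notin by blast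
  qed
qed (auto intro: mult_mem mult_mem_right)

lemma lg_mult:
  assumes "x \<notin> M" "y \<notin> M"
  shows "lg (x * y) = (lg x + lg y) mod N"
  using assms by (intro lg_eqI) (simp add: power_add cong_mult pow_lg)

lemma lg_eqD: "x \<notin> M \<Longrightarrow> y \<notin> M \<Longrightarrow> lg x = lg y \<Longrightarrow> x \<approx> y"
  using pow_lg[of x] cong_sym[OF pow_lg[of y]] cong_trans by auto

lemma frob_diff: "(x - y) ^ q \<approx> x ^ q - y ^ q"
  using minus_mem[OF frob[of "x - y" y]] by (simp add: cong_ideal_def algebra_simps)

text \<open>The q^2 residue classes are numbered 0, ..., N: an index below \<open>N\<close> is a
  logarithm, and \<open>N\<close> itself stands for 0.\<close>

definition elt :: "nat \<Rightarrow> 'a" where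
  "elt i = (if i < N then g ^ i else 0)"

definition idx :: "'a \<Rightarrow> nat" where
  "idx x = (if x \<in> M then N else lg x)"

lemma elt_idx: "elt (idx x) \<approx> x"
  using lg_less pow_lg by (auto simp: elt_def idx_def cong_0_iff[THEN iffD2] intro: cong_sym)

lemma idx_elt: "i \<le> N \<Longrightarrow> idx (elt i) = i"
  using lg_eqI[of "g ^ i" i] by (auto simp: elt_def idx_def pow_notin zero_mem)

lemma idx_cong: "x \<approx> y \<Longrightarrow> idx x = idx y"
  using cong_mem_iff[of x y] lg_cong[of x y] by (simp add: idx_def)

lemma elt_cong_iff: "i \<le> N \<Longrightarrow> j \<le> N \<Longrightarrow> elt i \<approx> elt j \<longleftrightarrow> i = j"
  by (metis cong_refl idx_cong idx_elt)

lemma pow_q2_cong: "x ^ q\<^sup>2 \<approx> x"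
proof (cases "x \<in> M")
  case True
  have "x ^ Suc N = x ^ N * x" by (simp add: mult.commute)
  then have "x ^ q\<^sup>2 \<in> M" using mult_mem[OF True] by (simp add: Suc_N)
  with True show ?thesis by (simp add: cong_ideal_def diff_mem)
next
  case False
  define k where "k = lg x"
  have k: "x \<approx> g ^ k" using pow_lg[OF False] by (simp add: k_def)
  then have "x ^ q\<^sup>2 \<approx> (g ^ k) ^ q\<^sup>2" by (rule cong_pow)
  also have "(g ^ k) ^ q\<^sup>2 = g ^ (k + k * N)"
    by (simp add: power_mult[symmetric] power_add[symmetric] Suc_N[symmetric])
  also have "\<dots> \<approx> g ^ k"
    by (simp add: pow_cong_iff Cong.cong_def)
  also have "\<dots> \<approx> x" using k by (rule cong_sym)
  finally show ?thesis .
qed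

text \<open>
  Homogeneous coordinates of the points of the projective line; the index \<open>q\<^sup>2\<close> is the point at
  infinity.
\<close>

definition pt :: "nat \<Rightarrow> 'a \<times> 'a" where
  "pt i = (if i < q\<^sup>2 then (1, elt i) else (0, 1))"

definition det2 :: "nat \<Rightarrow> nat \<Rightarrow> 'a" where
  "det2 i j = fst (pt i) * snd (pt j) - snd (pt i) * fst (pt j)"

lemma det2_mem_iff:
  assumes "i \<le> q\<^sup>2" "j \<le> q\<^sup>2"
  shows "det2 i j \<in> M \<longleftrightarrow> i = j"
proof -
  have "det2 i j \<in> M \<longleftrightarrow> elt j \<approx> elt i" if "i < q\<^sup>2" "j < q\<^sup>2"
    using that by (simp add: det2_def pt_def cong_ideal_def)
  then show ?thesis
    using assms elt_cong_iff[of j i] one_notin minus_mem[of "-1"]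
    by (auto simp: Suc_N[symmetric] det2_def pt_def less_Suc_eq_le zero_mem le_Suc_eq)
qed

lemma det2_plucker: "det2 x z * det2 y z' - det2 x z' * det2 y z = det2 x y * det2 z z'"
  by (simp add: det2_def algebra_simps)

text \<open>The sign is kept as a factor so that the logarithm of -1 can be added to that of the
  determinant.\<close>

lemma det2_minus: "det2 j i = - 1 * det2 i j"
  by (simp add: det2_def algebra_simps)

definition weight :: "nat \<Rightarrow> nat \<Rightarrow> int" where
  "weight x y = int (lg (det2 x y))"

text \<open>By the Pluecker identity, a ratio of two determinants determines the point.\<close>

lemma weight_balanced:
  assumes xy: "x \<le> q\<^sup>2" "y \<le> q\<^sup>2" "x \<noteq> y"
  shows "bij_betw (\<lambda>z. (weight x z - weight y z) mod int N) ({..q\<^sup>2} - {x, y}) {0..<int N}"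
proof -
  let ?f = "\<lambda>z. (weight x z - weight y z) mod int N"
  let ?Z = "{..q\<^sup>2} - {x, y}"
  have inj: "inj_on ?f ?Z"
  proof (rule inj_onI)
    fix z z' assume z: "z \<in> ?Z" "z' \<in> ?Z" and "?f z = ?f z'"
    then have "int N dvd (weight x z - weight y z) - (weight x z' - weight y z')"
      by (simp add: mod_eq_dvd_iff)
    then have "int N dvd (weight x z + weight y z') - (weight x z' + weight y z)"
      by (simp add: algebra_simps)
    then have "(lg (det2 x z) + lg (det2 y z')) mod N = (lg (det2 x z') + lg (det2 y z)) mod N"
      unfolding weight_def of_nat_add[symmetric] mod_eq_dvd_iff[symmetric] of_nat_mod[symmetric]
      by (simp only: of_nat_eq_iff)
    moreover have nin: "det2 x z \<notin> M" "det2 y z' \<notin> M" "det2 x z' \<notin> M" "det2 y z \<notin> M"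
      using z xy by (auto simp: det2_mem_iff)
    ultimately have "lg (det2 x z * det2 y z') = lg (det2 x z' * det2 y z)"
      by (simp add: lg_mult)
    then have "det2 x z * det2 y z' \<approx> det2 x z' * det2 y z"
      using nin by (intro lg_eqD) (auto simp: mult_mem_iff)
    then have "det2 x y * det2 z z' \<in> M"
      by (simp add: cong_ideal_def det2_plucker)
    then show "z = z'" using xy z by (auto simp: mult_mem_iff det2_mem_iff)
  qed
  \<comment> \<open>Of the q^2 + 1 points two are removed, leaving q^2 - 1 = N, so injectivity
    already gives surjectivity.\<close>
  have "card ?Z = N"
    using xy by (simp add: card_Diff_subset Suc_N[symmetric])
  moreover have "?f ` ?Z \<subseteq> {0..<int N}"
    using N_pos by auto
  ultimately have "?f ` ?Z = {0..<int N}"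
    using card_image[OF inj] by (intro card_subset_eq) auto
  with inj show ?thesis by (simp add: bij_betw_def)
qed

end

section \<open>The logarithm of -1 and the symmetry of the weights\<close>

locale galois_ideal_mod4 = galois_ideal +
  assumes q_mod_4: "q mod 4 = 1"
begin

lemma odd_q: "odd q"
  using q_mod_4 by presburger

lemma N_half: "N = 2 * (((q + 1) div 2) * (q - 1))"
  using odd_q by (auto simp: N_eq elim!: oddE)

text \<open>The exponent is N / 2: this power squares to 1 without being 1, and the quotient has no
  zero divisors.\<close>

lemma minus_1_cong: "- 1 \<approx> g ^ (((q + 1) div 2) * (q - 1))" (is "_ \<approx> g ^ ?h")
proof -
  have "(g ^ a - 1) * (g ^ a + 1) = g ^ (2 * a) - 1" for a
    by (simp only: mult_2 power_add) (simp add: algebra_simps)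
  then have "(g ^ ?h - 1) * (g ^ ?h + 1) = g ^ N - 1"
    by (simp only: N_half[symmetric])
  also have "\<dots> \<in> M" using pow_cong_1_iff[of N] by (simp add: cong_ideal_def)
  finally have "g ^ ?h - 1 \<in> M \<or> g ^ ?h + 1 \<in> M" by (simp only: mult_mem_iff)
  moreover have "\<not> N dvd ?h"
    using N_half N_pos by (metis dvd_imp_le mult_2 nat_0_less_mult_iff add_le_same_cancel1 leD zero_less_numeral)
  ultimately have "g ^ ?h + 1 \<in> M"
    using pow_cong_1_iff[of ?h] by (simp add: cong_ideal_def)
  moreover have "- 1 - g ^ ?h = - (g ^ ?h + 1)" by simp
  ultimately show ?thesis
    unfolding cong_ideal_def by (simp only: minus_mem)
qed

text \<open>For q = 4 k + 1 the logarithm N / 2 of -1 equals 2 (q + 1) k, so it vanishes modulo 2 (q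
  + 1).\<close>

lemma two_n_dvd: "2 * (q + 1) dvd N" "2 * (q + 1) dvd ((q + 1) div 2) * (q - 1)"
proof -
  define k where "k = q div 4"
  have k: "q = 4 * k + 1"
    using q_mod_4 by (simp add: k_def) presburger
  have "N = 2 * (q + 1) * (2 * k)" "((q + 1) div 2) * (q - 1) = 2 * (q + 1) * k"
    unfolding N_eq by (simp_all add: k algebra_simps)
  then show "2 * (q + 1) dvd N" "2 * (q + 1) dvd ((q + 1) div 2) * (q - 1)"
    by (simp_all only: dvd_triv_left)
qed

text \<open>The determinant is antisymmetric, and the logarithm of -1 is a multiple of 2 (q +
  1).\<close>

lemma weight_sym:
  assumes "x \<le> q\<^sup>2" "y \<le> q\<^sup>2" "x \<noteq> y"
  shows "2 * (int q + 1) dvd weight x y - weight y x"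
proof -
  let ?h = "((q + 1) div 2) * (q - 1)"
  have D: "det2 x y \<notin> M" using assms det2_mem_iff by blast
  have "det2 y x \<approx> g ^ ?h * g ^ lg (det2 x y)"
    unfolding det2_minus[of y x] by (intro cong_mult minus_1_cong pow_lg D)
  then have "lg (det2 y x) = (?h + lg (det2 x y)) mod N"
    by (intro lg_eqI) (simp add: power_add)
  then have "[lg (det2 y x) = ?h + lg (det2 x y)] (mod (2 * (q + 1)))"
    using two_n_dvd(1) by (simp add: Cong.cong_def mod_mod_cancel)
  moreover have "[?h + lg (det2 x y) = 0 + lg (det2 x y)] (mod (2 * (q + 1)))"
    by (intro Cong.cong_add Cong.cong_refl) (use two_n_dvd(2) in \<open>simp add: Cong.cong_0_iff\<close>)
  ultimately have "[lg (det2 x y) = lg (det2 y x)] (mod (2 * (q + 1)))"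
    by (simp only: Cong.cong_def add_0)
  then have "[int (lg (det2 x y)) = int (lg (det2 y x))] (mod int (2 * (q + 1)))"
    by (simp only: cong_int_iff)
  then show ?thesis
    by (simp add: weight_def cong_iff_dvd_diff algebra_simps)
qed

text \<open>
  The trace-like map \<open>x \<mapsto> x - x\<^sup>q\<close> takes values in a line over the subfield with \<open>q\<close> elements; a
  nonzero value has logarithm \<open>(q + 1) / 2 + (q + 1) t\<close>, and \<open>quad_sign\<close> reads off the parity of \<open>t\<close>.
\<close>

definition quad_sign :: "'a \<Rightarrow> int" where
  "quad_sign x = (if x \<in> M then 0 else if even (lg x div (q + 1)) then 1 else - 1)"

definition tr :: "'a \<Rightarrow> 'a" where
  "tr x = x - x ^ q"

definition conf :: "nat \<Rightarrow> int" where
  "conf m = quad_sign (tr (g ^ m))"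

lemma quad_sign_cong: "x \<approx> y \<Longrightarrow> quad_sign x = quad_sign y"
  using cong_mem_iff[of x y] lg_cong[of x y] by (simp add: quad_sign_def)

text \<open>Logarithms are determined only modulo N; as 2 (q + 1) divides N, the parity of their
  quotient by q + 1 is well defined.\<close>

lemma even_mod_div: "even (m mod N div (q + 1)) \<longleftrightarrow> even (m div (q + 1))"
proof -
  obtain c where "N = 2 * (q + 1) * c"
    using two_n_dvd(1) by (rule dvdE)
  then have c: "N = (q + 1) * (2 * c)" by (simp only: ac_simps)
  have "(q + 1) * (2 * c * (m div N)) = N * (m div N)"
    by (simp only: c mult.assoc)
  then have "m div (q + 1) = (m mod N + (q + 1) * (2 * c * (m div N))) div (q + 1)"
    by (simp only: mod_mult_div_eq)
  also have "\<dots> = 2 * c * (m div N) + m mod N div (q + 1)"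
    by (subst div_mult_self2) auto
  finally show ?thesis by simp
qed

lemma quad_sign_shift: "quad_sign (g ^ (q + 1) * x) = - quad_sign x"
proof (cases "x \<in> M")
  case False
  have "lg (g ^ (q + 1) * x) = (q + 1 + lg x) mod N"
    using pow_lg[OF False] by (intro lg_eqI) (simp only: power_add[of g "q + 1"] cong_mult cong_refl)
  then have "even (lg (g ^ (q + 1) * x) div (q + 1)) \<longleftrightarrow> even ((q + 1 + lg x) div (q + 1))"
    by (simp only: even_mod_div)
  also have "(q + 1 + lg x) div (q + 1) = Suc (lg x div (q + 1))"
    by (subst div_add_self1) auto
  finally show ?thesis
    using False by (simp only: quad_sign_def mult_pow_mem_iff) auto
qed (simp add: quad_sign_def mult_mem)

lemma tr_cong: "x \<approx> y \<Longrightarrow> tr x \<approx> tr y"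
  by (simp add: tr_def cong_diff cong_pow)

text \<open>\<open>g ^ (q + 1)\<close> lies in the subfield with q elements, because (q + 1) q = (q
  + 1) + N, and \<open>tr\<close> is linear over that subfield.\<close>

lemma tr_shift: "tr (g ^ (q + 1) * x) \<approx> g ^ (q + 1) * tr x"
proof -
  have eq: "(q + 1) * q = q + 1 + N"
    unfolding N_eq using q_gt_1 by (cases q) simp_all
  then have "(g ^ (q + 1)) ^ q \<approx> g ^ (q + 1)"
    by (simp only: power_mult[symmetric] pow_cong_iff Cong.cong_def eq mod_add_self2)
  then have "(g ^ (q + 1)) ^ q * x ^ q \<approx> g ^ (q + 1) * x ^ q"
    by (intro cong_mult cong_refl)
  then have "g ^ (q + 1) * x - (g ^ (q + 1)) ^ q * x ^ q \<approx> g ^ (q + 1) * x - g ^ (q + 1) * x ^ q"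
    by (intro cong_diff cong_refl)
  then show ?thesis
    by (simp only: tr_def power_mult_distrib right_diff_distrib)
qed

lemma conf_shift: "conf (m + (q + 1)) = - conf m"
proof -
  have "conf (m + (q + 1)) = quad_sign (tr (g ^ (q + 1) * g ^ m))"
    by (simp only: conf_def power_add mult.commute)
  also have "\<dots> = quad_sign (g ^ (q + 1) * tr (g ^ m))"
    by (intro quad_sign_cong tr_shift)
  finally show ?thesis by (simp only: quad_sign_shift conf_def)
qed

lemma conf_mod: "conf (m mod N) = conf m"
  unfolding conf_def by (intro quad_sign_cong tr_cong) (simp add: pow_cong_iff)

text \<open>\<open>tr\<close> vanishes where the q-th power map fixes g^m, that is, where N = (q +
  1)(q - 1) divides m (q - 1).\<close>

lemma tr_pow_mem_iff: "tr (g ^ m) \<in> M \<longleftrightarrow> (q + 1) dvd m"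
proof -
  have "tr (g ^ m) \<in> M \<longleftrightarrow> [m = m * q] (mod N)"
    by (simp add: tr_def power_mult[symmetric] cong_ideal_def[symmetric] pow_cong_iff)
  also have "\<dots> \<longleftrightarrow> N dvd m * q - m"
    using q_gt_1 by (subst Cong.cong_sym_eq) (simp add: cong_altdef_nat)
  also have "m * q - m = m * (q - 1)" by (simp add: algebra_simps)
  also have "N dvd m * (q - 1) \<longleftrightarrow> (q + 1) dvd m"
    unfolding N_eq mult.commute[of _ "q - 1"] nat_mult_dvd_cancel_disj using q_gt_1 by simp
  finally show ?thesis .
qed

lemma conf_eq_0_iff: "conf m = 0 \<longleftrightarrow> (q + 1) dvd m"
  unfolding conf_def quad_sign_def tr_pow_mem_iff[symmetric] by auto

lemma conf_cases: "conf m \<in> {- 1, 0, 1}"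
  by (simp add: conf_def quad_sign_def)

definition tr_range :: "nat set" where
  "tr_range = insert N ((\<lambda>k. (q + 1) div 2 + (q + 1) * k) ` {..<q - 1})"

lemma card_tr_range: "card tr_range \<le> q"
proof -
  have "card tr_range \<le> Suc (card ((\<lambda>k. (q + 1) div 2 + (q + 1) * k) ` {..<q - 1}))"
    unfolding tr_range_def by (rule card_insert_le_m1) auto
  also have "card ((\<lambda>k. (q + 1) div 2 + (q + 1) * k) ` {..<q - 1}) \<le> card {..<q - 1}"
    by (rule card_image_le) simp
  finally show ?thesis using q_gt_1 by simp
qed

text \<open>The q-th power map negates tr x. In logarithms, m (q - 1) is congruent to ((q + 1) /
  2)(q - 1) modulo (q + 1)(q - 1), which leaves m = (q + 1) / 2 modulo q + 1.\<close>

lemma idx_tr: "idx (tr x) \<in> tr_range"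
proof (cases "tr x \<in> M")
  case False
  define m where "m = lg (tr x)"
  let ?h = "((q + 1) div 2) * (q - 1)"
  have m: "m < N" "tr x \<approx> g ^ m"
    using lg_less[OF False] pow_lg[OF False] by (simp_all add: m_def)
  have "tr x ^ q \<approx> x ^ q - x ^ q\<^sup>2"
    using frob_diff[of x "x ^ q"] by (simp add: tr_def power_mult[symmetric] power2_eq_square)
  also have "\<dots> \<approx> x ^ q - x" by (intro cong_diff cong_refl pow_q2_cong)
  also have "x ^ q - x = - 1 * tr x" by (simp add: tr_def)
  also have "\<dots> \<approx> g ^ ?h * g ^ m" by (intro cong_mult minus_1_cong m)
  finally have "(g ^ m) ^ q \<approx> g ^ ?h * g ^ m"
    using cong_trans[OF cong_sym[OF cong_pow[OF m(2)]]] by blast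
  then have "[m * q = ?h + m] (mod N)"
    by (simp only: power_mult[symmetric] power_add[symmetric] pow_cong_iff)
  then have "[int (m * q) = int (?h + m)] (mod int N)"
    by (simp only: cong_int_iff)
  then have "int N dvd int (m * q) - int (?h + m)"
    by (simp only: cong_iff_dvd_diff)
  also have "int (m * q) - int (?h + m) = (int m - int ((q + 1) div 2)) * int (q - 1)"
    unfolding of_nat_mult of_nat_add of_nat_diff[OF less_imp_le[OF q_gt_1]] of_nat_1
    by (simp only: algebra_simps)
  finally have "int (q + 1) * int (q - 1) dvd (int m - int ((q + 1) div 2)) * int (q - 1)"
    by (simp only: N_eq of_nat_mult)
  then have "int (q + 1) dvd int m - int ((q + 1) div 2)"
    using q_gt_1 by (simp only: dvd_mult_cancel_right) auto
  then have "[m = (q + 1) div 2] (mod (q + 1))"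
    by (simp only: cong_iff_dvd_diff[symmetric] cong_int_iff)
  then have "m mod (q + 1) = (q + 1) div 2"
    by (simp add: Cong.cong_def)
  then have "m = (q + 1) div 2 + (q + 1) * (m div (q + 1))"
    by (metis add.commute mult_div_mod_eq)
  moreover have "m div (q + 1) < q - 1"
    using m(1) unfolding N_eq by (simp add: less_mult_imp_div_less mult.commute)
  ultimately show ?thesis
    using False by (auto simp: idx_def tr_range_def m_def)
qed (simp add: idx_def tr_range_def)

text \<open>The signs alternate along the q - 1 nonzero values, an even number of them, and 0
  contributes nothing.\<close>

lemma sum_quad_sign_tr_range: "(\<Sum>i\<in>tr_range. quad_sign (elt i)) = 0"
proof -
  let ?u = "\<lambda>k. (q + 1) div 2 + (q + 1) * k"
  have less: "?u k < N" if "k < q - 1" for k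
  proof -
    have "?u k < (q + 1) * (k + 1)" using q_gt_1 by simp
    also have "\<dots> \<le> (q + 1) * (q - 1)" using that by (intro mult_le_mono) auto
    finally show ?thesis by (simp add: N_eq)
  qed
  have inj: "inj_on ?u {..<q - 1}" by (rule inj_onI) (simp only: add_left_cancel mult_cancel1, simp)
  have nin: "N \<notin> ?u ` {..<q - 1}" using less by fastforce
  have val: "quad_sign (elt (?u k)) = (-1) ^ k" if "k < q - 1" for k
  proof -
    have "lg (g ^ ?u k) = ?u k" using lg_eqI[of "g ^ ?u k" "?u k"] less[OF that] by simp
    moreover have "?u k div (q + 1) = k + (q + 1) div 2 div (q + 1)"
      by (rule div_mult_self2) simp
    then have "?u k div (q + 1) = k" by (subst (asm) div_less[of "(q + 1) div 2"]) auto
    ultimately show ?thesis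
      using less[OF that] pow_notin[of "?u k"] by (simp add: elt_def quad_sign_def)
  qed
  have alt: "(\<Sum>k<2 * b. (-1 :: int) ^ k) = 0" for b
    by (induction b) simp_all
  have "(\<Sum>i\<in>tr_range. quad_sign (elt i)) = quad_sign (elt N) + (\<Sum>k<q - 1. quad_sign (elt (?u k)))"
    unfolding tr_range_def sum.insert[OF finite_imageI[OF finite_lessThan] nin] sum.reindex[OF inj]
    by (simp only: o_def)
  also have "(\<Sum>k<q - 1. quad_sign (elt (?u k))) = (\<Sum>k<q - 1. (-1) ^ k)"
    by (intro sum.cong refl val) simp
  also have "q - 1 = 2 * ((q - 1) div 2)" using odd_q by simp
  also note alt
  finally show ?thesis by (simp add: elt_def quad_sign_def zero_mem)
qed

text \<open>
  For \<open>h = g\<^sup>t\<close> outside the subfield with \<open>q\<close> elements the pair \<open>(tr x, tr (h x))\<close> determines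
  \<open>x\<close>, so that by counting the pair takes every value once and the correlation factors.
\<close>

lemma conf_correlation:
  assumes t: "\<not> (q + 1) dvd t"
  shows "(\<Sum>m<N. conf m * conf (m + t)) = 0"
proof -
  let ?U = tr_range
  define \<Phi> where "\<Phi> i = (idx (tr (elt i)), idx (tr (g ^ t * elt i)))" for i
  have finU: "finite ?U" by (simp add: tr_range_def)
  have tr_diff: "tr (x - y) \<in> M" if "idx (tr x) = idx (tr y)" for x y
  proof -
    have "tr x \<approx> tr y"
      using cong_trans[OF cong_sym[OF elt_idx[of "tr x"]]] elt_idx[of "tr y"] that by simp
    moreover have "tr (x - y) \<approx> tr x - tr y"
      using cong_diff[OF cong_refl[of "x - y"] frob_diff[of x y]]
      by (simp add: tr_def algebra_simps)
    ultimately show ?thesis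
      using cong_mem_iff by (simp add: cong_ideal_def[of "tr x"])
  qed
  have inj: "inj_on \<Phi> {..N}"
  proof (rule inj_onI)
    fix i j assume ij: "i \<in> {..N}" "j \<in> {..N}" and eq: "\<Phi> i = \<Phi> j"
    define d where "d = elt i - elt j"
    have 1: "d - d ^ q \<in> M"
      using tr_diff[of "elt i" "elt j"] eq by (simp add: \<Phi>_def d_def tr_def)
    have "tr (g ^ t * elt i - g ^ t * elt j) \<in> M"
      using eq by (intro tr_diff) (simp add: \<Phi>_def)
    then have 2: "g ^ t * d - (g ^ t) ^ q * d ^ q \<in> M"
      by (simp add: tr_def d_def right_diff_distrib[symmetric] power_mult_distrib)
    \<comment> \<open>Eliminating d^q from the two relations leaves a multiple of d, whose
      coefficient tr (g^t) is nonzero modulo M by the assumption on \<open>t\<close>.\<close>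
    have "tr (g ^ t) * d = (g ^ t * d - (g ^ t) ^ q * d ^ q) - (g ^ t) ^ q * (d - d ^ q)"
      by (simp add: tr_def algebra_simps)
    also have "\<dots> \<in> M" by (intro diff_mem mult_mem 1 2)
    finally have "d \<in> M" using t by (simp add: mult_mem_iff tr_pow_mem_iff)
    then show "i = j" using ij elt_cong_iff by (simp add: d_def cong_ideal_def)
  qed
  have sub: "\<Phi> ` {..N} \<subseteq> ?U \<times> ?U"
    using idx_tr by (auto simp: \<Phi>_def)
  have "card (?U \<times> ?U) \<le> q * q"
    unfolding card_cartesian_product by (intro mult_le_mono card_tr_range)
  also have "\<dots> = card (\<Phi> ` {..N})"
    by (simp add: card_image[OF inj] Suc_N power2_eq_square)
  finally have "\<Phi> ` {..N} = ?U \<times> ?U"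
    using sub finU by (intro card_seteq) auto
  then have bij: "bij_betw \<Phi> {..N} (?U \<times> ?U)"
    using inj by (simp add: bij_betw_def)
  let ?f = "\<lambda>x. quad_sign (tr x) * quad_sign (tr (g ^ t * x))"
  have "0 ^ q = (0 :: 'a)" using q_gt_1 by (intro zero_power) simp
  then have "tr 0 \<in> M" by (simp add: tr_def zero_mem)
  then have f0: "?f 0 = 0" by (simp add: quad_sign_def)
  have "{..N} = insert N {..<N}" by auto
  then have "(\<Sum>i\<le>N. ?f (elt i)) = ?f 0 + (\<Sum>m<N. ?f (elt m))"
    by (simp add: elt_def)
  also have "(\<Sum>m<N. ?f (elt m)) = (\<Sum>m<N. conf m * conf (m + t))"
    by (intro sum.cong refl) (simp add: elt_def conf_def power_add mult.commute)
  finally have "(\<Sum>m<N. conf m * conf (m + t)) = (\<Sum>i\<le>N. ?f (elt i))"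
    by (simp only: f0 add_0)
  also have "\<dots> = (\<Sum>i\<le>N. (\<lambda>(u, v). quad_sign (elt u) * quad_sign (elt v)) (\<Phi> i))"
    using quad_sign_cong[OF elt_idx] by (simp add: \<Phi>_def)
  also have "\<dots> = (\<Sum>(u, v)\<in>?U \<times> ?U. quad_sign (elt u) * quad_sign (elt v))"
    by (rule sum.reindex_bij_betw[OF bij])
  also have "\<dots> = (\<Sum>u\<in>?U. quad_sign (elt u)) * (\<Sum>v\<in>?U. quad_sign (elt v))"
    by (simp add: sum_product sum.cartesian_product)
  finally show ?thesis by (simp add: sum_quad_sign_tr_range)
qed

lemma siamese_weight: "siamese q weight (\<lambda>j. conf (nat (j mod int N)))"
proof -
  let ?s = "\<lambda>j :: int. conf (nat (j mod int N))"
  have Nq: "int N = int q ^ 2 - 1"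
    using Suc_N by (metis add_diff_cancel_left' of_nat_Suc of_nat_power)
  \<comment> \<open>\<open>conf\<close> lives on naturals and has period \<open>N\<close>, so
    reducing modulo \<open>N\<close> extends it to all integers compatibly with shifts.\<close>
  have s_plus: "?s (j + int k) = conf (nat (j mod int N) + k)" for j k
  proof -
    have "(nat (j mod int N) + k) mod N = nat ((j mod int N + int k) mod int N)"
      using N_pos by (simp add: nat_mod_distrib nat_add_distrib)
    also have "\<dots> = nat ((j + int k) mod int N)" by (simp add: mod_add_left_eq)
    finally have "conf ((nat (j mod int N) + k) mod N) = ?s (j + int k)" by simp
    then show ?thesis by (simp only: conf_mod)
  qed
  have s_int: "?s (int k) = conf k" for k
    using s_plus[of 0 k] by simp
  have neg: "negacyclic (q + 1) ?s"
    unfolding negacyclic_def s_plus conf_shift by simp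
  have dvd_N: "int (q + 1) dvd int N" by (simp only: N_eq of_nat_mult dvd_triv_left)
  have dvd_iff: "(q + 1) dvd nat (j mod int N) \<longleftrightarrow> int (q + 1) dvd j" for j
  proof -
    have "(q + 1) dvd nat (j mod int N) \<longleftrightarrow> int (q + 1) dvd j mod int N"
      using N_pos by (simp only: int_dvd_int_iff[symmetric]) simp
    then show ?thesis using dvd_N by (simp only: dvd_mod_iff)
  qed
  have corr: "(\<Sum>c<q + 1. ?s (int c) * ?s (int c + t)) = 0" if t: "\<not> int (q + 1) dvd t" for t
  proof -
    let ?T = "nat (t mod int N)"
    let ?h = "\<lambda>m. ?s m * ?s (m + t)"
    have per: "?h (m + int (q + 1)) = ?h m" for m
    proof -
      have "?s (m + int (q + 1)) = - ?s m" "?s (m + t + int (q + 1)) = - ?s (m + t)"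
        using neg unfolding negacyclic_def by blast+
      moreover have "m + int (q + 1) + t = m + t + int (q + 1)" by simp
      ultimately show ?thesis by (simp only: minus_mult_minus)
    qed
    \<comment> \<open>The known correlation runs over N = (q - 1)(q + 1) terms. The product has
      period q + 1, so this is q - 1 times the sum wanted, and q - 1 is nonzero.\<close>
    have "(\<Sum>k<(q - 1) * (q + 1). ?h (int k + 0)) = of_nat (q - 1) * (\<Sum>c<q + 1. ?h (int c))"
      by (rule sum_periodic_multiple[of _ ?h, OF _ per]) simp
    moreover have "?h (int k + 0) = conf k * conf (k + ?T)" for k
      using s_plus[of t k] s_int[of k] by (simp add: add.commute)
    moreover have "(\<Sum>k<N. conf k * conf (k + ?T)) = 0"
      using t by (intro conf_correlation) (simp only: dvd_iff not_False_eq_True)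
    ultimately have "of_nat (q - 1) * (\<Sum>c<q + 1. ?h (int c)) = 0"
      by (simp only: N_eq mult.commute)
    then show ?thesis using q_gt_1 by simp
  qed
  show ?thesis
  proof
    show "odd q" by (rule odd_q)
    show "negacyclic (q + 1) ?s" by (rule neg)
    show "?s m \<in> {- 1, 0, 1}" for m by (rule conf_cases)
    show "?s m = 0 \<longleftrightarrow> int (q + 1) dvd m" for m by (simp only: conf_eq_0_iff dvd_iff)
  qed (use weight_sym weight_balanced corr in \<open>simp_all only: Nq[symmetric]\<close>)
qed

end

theorem theorem3p3:
  fixes q v :: nat
  assumes "primepow q" and "q mod 4 = 1"
    and "v = 1 + q + q ^ 2 + q ^ 3"
  shows "(\<exists>W \<Gamma>. butson_weighing 4 v (q + q ^ 2) W \<and> quasi_balanced W \<and>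
            strongly_regular v (q + q ^ 2) (q - 1) (q + 1) \<Gamma> \<and>
            abs_mat W = adjacency_mat v \<Gamma>)
       \<and> (\<exists>(W :: nat \<Rightarrow> complex mat) (\<Gamma> :: nat \<Rightarrow> nat pair_pre_digraph) F.
            (\<forall>l\<le>q. strongly_regular v (q + q ^ 2) (q - 1) (q + 1) (\<Gamma> l) \<and>
                   signed_over_by 4 v (q + q ^ 2) (\<Gamma> l) (W l)) \<and>
            pair_graph F \<and> pverts F = pverts (complete_pair_graph v) \<and>
            disjoint_union_of_cliques (1 + q ^ 2) (q + 1) F \<and>
            (\<forall>e\<in>parcs F. \<forall>l\<le>q. e \<in> parcs (\<Gamma> l)) \<and>
            (\<forall>e\<in>parcs (complete_pair_graph v) - parcs F. \<exists>!l. l \<le> q \<and> e \<in> parcs (\<Gamma> l)))"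
proof -
  obtain p e where "prime p" "e > 0" and q: "q = p ^ e"
    using assms(1) by (auto simp: primepow_def)
  then obtain M :: "int poly set" where "galois_ideal M [:0, 1:] q"
    using exists_galois_ideal by metis
  then have "galois_ideal_mod4 M [:0, 1:] q"
    using assms(2) by (intro galois_ideal_mod4.intro galois_ideal_mod4_axioms.intro)
  then obtain w s where "siamese q w s"
    using galois_ideal_mod4.siamese_weight by blast
  then interpret siamese q w s .
  have v: "v = siamese.v q" using assms(3) by (simp add: v_eq)
  have "pverts F = pverts (complete_pair_graph v)"
    by (simp add: F_def complete_pair_graph_def v)
  then show ?thesis
    unfolding v
    using butson_weighing_W quasi_balanced_W strongly_regular_\<Gamma> abs_W signed_\<Gamma>
      pair_graph_F disjoint_union_of_cliques_F F_in_\<Gamma> unique_\<Gamma> by blast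
qed

end
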